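(* Consider the continuum-limit equation $$\partial_t x(t,\xi)=\int_0^1 \sin\big(x(t,z)-x(t,\xi)\big)\,\mathrm{d}z,\qquad \xi\in[0,1],\qquad(\ast)$$ for $\mathbb{R}/2\pi\mathbb{Z}$-valued functions $x(t,\cdot)$. For every $q\in\mathbb{R}/2\pi\mathbb{Z}$, the incoherent equilibrium (twisted state) $y_q(\xi):=2\pi\xi+q$ of $(\ast)$ has a 2-dimensional unstable manifold, given explicitly by $$W^{\mathrm{u}}(y_q)=\left\{\xi\mapsto F^{-1}_{\alpha,\beta}\Big(\xi+C(\alpha,\beta)+\frac{q}{2\pi}\Big)\ \bigg|\ \beta\in[0,1),\ \alpha\in[-\pi,\pi]\right\},$$ where $$C(\alpha,\beta)=-\frac1\pi\arctan\left(\frac{\beta\sin\alpha}{1-\beta\cos\alpha}\right).$$ Moreover, the parameters $(\alpha,\beta)$ of $W^{\mathrm{u}}(y_q)$ and of the Ott-Antonsen manifold $\mathcal{M}_{OA}=\{f_{\alpha,\beta}\mid \beta\in[0,1),\ \alpha\in[-\pi,\pi]\}$ evolve according to the same system of ODEs $$\dot\beta=\tfrac12\beta(1-\beta^2),\qquad \dot\alpha=0.$$ That is, whenever $(\alpha(t),\beta(t))$ solves this system with $\beta(t)\in[0,1)$, the function $x(t,\xi)=F^{-1}_{\alpha(t),\beta(t)}\big(\xi+C(\alpha(t),\beta(t))+\frac{q}{2\pi}\big)$ solves $(\ast)$, and $f_{\alpha(t),\beta(t)}$ solves the mean-field equation $$\partial_t f(\theta,t)=\partial_\theta\left[f(\theta,t)\int_0^{2\pi}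 f(\phi,t)\sin(\theta-\phi)\,\mathrm{d}\phi\right].$$
   Context: For $\alpha\in[-\pi,\pi]$ and $\beta\in[0,1)$, define the $2\pi$-periodic probability density $$f_{\alpha,\beta}(\theta)=\frac{1}{2\pi}\,\frac{1-\beta^2}{1-2\beta\cos(\alpha+\theta)+\beta^2}$$ and its circular cumulative distribution function $$F_{\alpha,\beta}(\theta)=\int_0^\theta f_{\alpha,\beta}(\phi)\,\mathrm{d}\phi=\frac{\theta}{2\pi}+\frac1\pi\left(\arctan\frac{\beta\sin(\theta+\alpha)}{1-\beta\cos(\theta+\alpha)}-\arctan\frac{\beta\sin\alpha}{1-\beta\cos\alpha}\right).$$ $F_{\alpha,\beta}$ is an increasing bijection $[0,2\pi]\to[0,1]$. Identifying the endpoints of both intervals, it is regarded as a bijection $\mathbb{R}/2\pi\mathbb{Z}\to\mathbb{R}/\mathbb{Z}$, and $F_{\alpha,\beta}^{-1}:\mathbb{R}/\mathbb{Z}\to\mathbb{R}/2\pi\mathbb{Z}$ denotes its inverse, so arguments of $F^{-1}_{\alpha,\beta}$ are read modulo $1$ and values modulo $2\pi$. Unstable manifold is meant in the standard sense. The equation $(\ast)$ is viewed as an evolution equation for bounded measurable functions $x(t,\cdot):[0,1]\to\mathbb{R}/2\pi\mathbb{Z}$ with the $L^\infty$ (uniform) topology. $W^{\mathrm{u}}(y_q)$ is the set of states $x_0$ through which there is a solution of $(\ast)$ defined for all $t\le 0$, with $x(0,\cdot)=x_0$ and $x(t,\cdot)\to y_q$ as $t\to-\infty$. *)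

theory Defs
  imports "HOL-Analysis.Analysis"
begin

section \<open>The circle \<open>\<real>/2\<pi>\<int>\<close>\<close>

definition cong_2pi :: "real \<Rightarrow> real \<Rightarrow> bool" where
  "cong_2pi a b \<longleftrightarrow> (\<exists>k::int. a - b = 2 * pi * of_int k)"

quotient_type angle = real / cong_2pi
  morphisms rep_angle to_angle
proof (rule equivpI)
  show "reflp cong_2pi"
    by (auto simp: reflp_def cong_2pi_def intro: exI[of _ 0])
  show "symp cong_2pi"
    unfolding symp_def cong_2pi_def
  proof (intro allI impI)
    fix x y assume "\<exists>k::int. x - y = 2 * pi * of_int k"
    then obtain k :: int where "x - y = 2 * pi * of_int k" ..
    then have "y - x = 2 * pi * of_int (- k)" by simp
    then show "\<exists>k::int. y - x = 2 * pi * of_int k" ..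
  qed
  show "transp cong_2pi"
    unfolding transp_def cong_2pi_def
  proof (intro allI impI)
    fix x y z
    assume "\<exists>k::int. x - y = 2 * pi * of_int k" "\<exists>k::int. y - z = 2 * pi * of_int k"
    then obtain k l :: int where "x - y = 2 * pi * of_int k" "y - z = 2 * pi * of_int l" by blast
    then have "x - z = 2 * pi * of_int (k + l)" by (simp add: distrib_left)
    then show "\<exists>k::int. x - z = 2 * pi * of_int k" ..
  qed
qed

instantiation angle :: ab_group_add
begin

lift_definition zero_angle :: angle is 0 .

lift_definition plus_angle :: "angle \<Rightarrow> angle \<Rightarrow> angle" is "(+)"
  unfolding cong_2pi_def
proof -
  fix a b c d :: real
  assume "\<exists>k::int. a - b = 2 * pi * of_int k" "\<exists>k::int. c - d = 2 * pi * of_int k"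
  then obtain k l :: int where "a - b = 2 * pi * of_int k" "c - d = 2 * pi * of_int l" by blast
  then have "a + c - (b + d) = 2 * pi * of_int (k + l)" by (simp add: distrib_left)
  then show "\<exists>k::int. a + c - (b + d) = 2 * pi * of_int k" ..
qed

lift_definition uminus_angle :: "angle \<Rightarrow> angle" is uminus
  unfolding cong_2pi_def
proof -
  fix a b :: real
  assume "\<exists>k::int. a - b = 2 * pi * of_int k"
  then obtain k :: int where "a - b = 2 * pi * of_int k" ..
  then have "- a - - b = 2 * pi * of_int (- k)" by simp
  then show "\<exists>k::int. - a - - b = 2 * pi * of_int k" ..
qed

definition minus_angle :: "angle \<Rightarrow> angle \<Rightarrow> angle" where
  "minus_angle x y = x + (- y)"

lemma cong_2pi_eq: "a = b \<Longrightarrow> cong_2pi a b"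
  by (auto simp: cong_2pi_def intro: exI[of _ 0])

instance
proof
  fix a b c :: angle
  show "a + b + c = a + (b + c)"
    by transfer (simp add: cong_2pi_eq)
  show "a + b = b + a"
    by transfer (simp add: cong_2pi_eq)
  show "0 + a = a"
    by transfer (simp add: cong_2pi_eq)
  show "- a + a = 0"
    by transfer (simp add: cong_2pi_eq)
  show "a - b = a + - b"
    by (simp add: minus_angle_def)
qed

end

lemma INF_dist_lattice:
  fixes d :: real
  shows "(INF k::int. \<bar>d - 2 * pi * of_int k\<bar>) = \<bar>d - 2 * pi * of_int (round (d / (2 * pi)))\<bar>"
proof (rule cInf_eq_minimum)
  show "\<bar>d - 2 * pi * of_int (round (d / (2 * pi)))\<bar> \<in> range (\<lambda>k::int. \<bar>d - 2 * pi * of_int k\<bar>)"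
    by blast
next
  fix x assume "x \<in> range (\<lambda>k::int. \<bar>d - 2 * pi * of_int k\<bar>)"
  then obtain k :: int where x: "x = \<bar>d - 2 * pi * of_int k\<bar>" by blast
  have scale: "\<bar>d - 2 * pi * of_int m\<bar> = 2 * pi * \<bar>d / (2 * pi) - of_int m\<bar>" for m :: int
  proof -
    have "d - 2 * pi * of_int m = 2 * pi * (d / (2 * pi) - of_int m)"
      by (simp add: field_simps)
    then show ?thesis by (simp add: abs_mult)
  qed
  show "\<bar>d - 2 * pi * of_int (round (d / (2 * pi)))\<bar> \<le> x"
    unfolding x scale using round_diff_minimal[of "d / (2 * pi)" k] by simp
qed

lemma INF_dist_lattice_le:
  fixes d :: real
  shows "(INF k::int. \<bar>d - 2 * pi * of_int k\<bar>) \<le> \<bar>d - 2 * pi * of_int m\<bar>"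
  by (rule cINF_lower) (auto intro: bdd_belowI[of _ 0])

instantiation angle :: metric_space
begin

lift_definition dist_angle :: "angle \<Rightarrow> angle \<Rightarrow> real"
  is "\<lambda>a b. INF k::int. \<bar>a - b - 2 * pi * of_int k\<bar>"
proof -
  fix a b c d :: real
  assume "cong_2pi a b" "cong_2pi c d"
  then obtain k l :: int where "a - b = 2 * pi * of_int k" "c - d = 2 * pi * of_int l"
    unfolding cong_2pi_def by blast
  then have eq: "a - c = b - d + 2 * pi * of_int (k - l)" by (simp add: algebra_simps)
  have "range (\<lambda>m::int. \<bar>a - c - 2 * pi * of_int m\<bar>) = range (\<lambda>m::int. \<bar>b - d - 2 * pi * of_int m\<bar>)"
  proof (intro equalityI subsetI; elim rangeE)
    fix x m assume "x = \<bar>a - c - 2 * pi * of_int m\<bar>"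
    then have "x = \<bar>b - d - 2 * pi * of_int (m - (k - l))\<bar>" by (simp add: eq algebra_simps)
    then show "x \<in> range (\<lambda>m::int. \<bar>b - d - 2 * pi * of_int m\<bar>)" by blast
  next
    fix x m assume "x = \<bar>b - d - 2 * pi * of_int m\<bar>"
    then have "x = \<bar>a - c - 2 * pi * of_int (m + (k - l))\<bar>" by (simp add: eq algebra_simps)
    then show "x \<in> range (\<lambda>m::int. \<bar>a - c - 2 * pi * of_int m\<bar>)" by blast
  qed
  then show "(INF m::int. \<bar>a - c - 2 * pi * of_int m\<bar>) = (INF m::int. \<bar>b - d - 2 * pi * of_int m\<bar>)"
    by (rule arg_cong)
qed

definition uniformity_angle :: "(angle \<times> angle) filter" where
  "uniformity_angle = (INF e\<in>{0<..}. principal {(x, y). dist x y < e})"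

definition open_angle :: "angle set \<Rightarrow> bool" where
  "open_angle U \<longleftrightarrow> (\<forall>x\<in>U. \<forall>\<^sub>F (x', y) in uniformity. x' = x \<longrightarrow> y \<in> U)"

instance
proof
  fix x y :: angle
  show "dist x y = 0 \<longleftrightarrow> x = y"
  proof (transfer, unfold cong_2pi_def)
    fix a b :: real
    have "\<bar>a - b - 2 * pi * of_int m\<bar> = 0 \<Longrightarrow> (INF k::int. \<bar>a - b - 2 * pi * of_int k\<bar>) = 0" for m
      using INF_dist_lattice_le[of "a - b" m] INF_dist_lattice[of "a - b"] by linarith
    then show "(INF k::int. \<bar>a - b - 2 * pi * of_int k\<bar>) = 0 \<longleftrightarrow>
        (\<exists>k::int. a - b = 2 * pi * of_int k)"
      using INF_dist_lattice[of "a - b"] by fastforce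
  qed
next
  fix x y z :: angle
  show "dist x y \<le> dist x z + dist y z"
  proof transfer
    fix a b c :: real
    define k where "k = round ((a - c) / (2 * pi))"
    define l where "l = round ((b - c) / (2 * pi))"
    have "(INF m::int. \<bar>a - b - 2 * pi * of_int m\<bar>) \<le> \<bar>a - b - 2 * pi * of_int (k - l)\<bar>"
      by (rule INF_dist_lattice_le)
    also have "\<dots> = \<bar>(a - c - 2 * pi * of_int k) - (b - c - 2 * pi * of_int l)\<bar>"
      by (simp add: algebra_simps)
    also have "\<dots> \<le> \<bar>a - c - 2 * pi * of_int k\<bar> + \<bar>b - c - 2 * pi * of_int l\<bar>"
      by (rule abs_triangle_ineq4)
    finally show "(INF m::int. \<bar>a - b - 2 * pi * of_int m\<bar>) \<le>
        (INF m::int. \<bar>a - c - 2 * pi * of_int m\<bar>) + (INF m::int. \<bar>b - c - 2 * pi * of_int m\<bar>)"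
      by (simp only: INF_dist_lattice k_def l_def)
  qed
qed (simp_all add: uniformity_angle_def open_angle_def)

end

lift_definition sin_angle :: "angle \<Rightarrow> real" is sin
proof -
  fix a b :: real
  assume "cong_2pi a b"
  then obtain k :: int where "a - b = 2 * pi * of_int k"
    unfolding cong_2pi_def by blast
  then have "a = b + 2 * pi * of_int k" by simp
  then show "sin a = sin b" by (simp add: sin_add cos_int_2pin sin_int_2pin)
qed


section \<open>The continuum-limit equation\<close>

text \<open>
  States are the (Lebesgue) measurable maps \<open>[0,1] \<rightarrow> \<real>/2\<pi>\<int>\<close> with the uniform metric;
  boundedness is automatic. They are honest functions, not classes modulo null sets, and are
  taken to be \<^const>\<open>undefined\<close> outside \<open>[0,1]\<close>.
\<close>

definition state_space :: "(real \<Rightarrow> angle) metric" where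
  "state_space = submetric (funspace {0..1} euclidean_metric) (borel_measurable (lebesgue_on {0..1}))"

definition kuramoto_rhs :: "(real \<Rightarrow> angle) \<Rightarrow> real \<Rightarrow> real" where
  "kuramoto_rhs x \<xi> = integral {0..1} (\<lambda>z. sin_angle (x z - x \<xi>))"

text \<open>
  A curve of states has derivative \<open>V\<close> at \<open>t\<close> if for \<open>s\<close> near \<open>t\<close> its displacement
  \<open>x(s) - x(t)\<close> is represented by a real-valued \<open>h(s)\<close> with \<open>h(s) / (s - t) \<rightarrow> V\<close> in the
  sup norm.
\<close>

definition has_state_derivative ::
    "(real \<Rightarrow> real \<Rightarrow> angle) \<Rightarrow> (real \<Rightarrow> real) \<Rightarrow> real filter \<Rightarrow> real \<Rightarrow> bool" where
  "has_state_derivative x V F t \<longleftrightarrow>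
     (\<exists>h :: real \<Rightarrow> real \<Rightarrow> real.
        (\<forall>\<^sub>F s in F. \<forall>\<xi>\<in>{0..1}. x s \<xi> = x t \<xi> + to_angle (h s \<xi>)) \<and>
        uniform_limit {0..1} (\<lambda>s \<xi>. h s \<xi> / (s - t)) V F)"

definition kuramoto_solution :: "real set \<Rightarrow> (real \<Rightarrow> real \<Rightarrow> angle) \<Rightarrow> bool" where
  "kuramoto_solution T x \<longleftrightarrow>
     (\<forall>t\<in>T. x t \<in> mspace state_space \<and>
        has_state_derivative x (kuramoto_rhs (x t)) (at t within T) t)"

definition unstable_manifold :: "(real \<Rightarrow> angle) \<Rightarrow> (real \<Rightarrow> angle) set" where
  "unstable_manifold y =
     {x\<^sub>0. \<exists>x. kuramoto_solution {..0} x \<and> x 0 = x\<^sub>0 \<and>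
        limitin (mtopology_of state_space) x y at_bot}"

text \<open>The real number \<open>q\<close> represents a point of \<open>\<real>/2\<pi>\<int>\<close>.\<close>

definition twisted_state :: "real \<Rightarrow> real \<Rightarrow> angle" where
  "twisted_state q = (\<lambda>\<xi>\<in>{0..1}. to_angle (2 * pi * \<xi> + q))"


section \<open>Two-dimensional submanifolds of the state space\<close>

text \<open>
  \<open>has_Linf_partials p \<Phi> A B\<close>: the map \<open>\<Phi>\<close> from the plane to the bounded real functions on
  \<open>[0,1]\<close> with the sup norm is Frechet differentiable at \<open>p\<close>, with derivative
  \<open>(u, v) \<mapsto> u A + v B\<close>.
\<close>

definition has_Linf_partials ::
    "real \<times> real \<Rightarrow> (real \<times> real \<Rightarrow> real \<Rightarrow> real) \<Rightarrow> (real \<Rightarrow> real) \<Rightarrow> (real \<Rightarrow> real) \<Rightarrow> bool" where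
  "has_Linf_partials p \<Phi> A B \<longleftrightarrow>
     uniform_limit {0..1}
       (\<lambda>p' \<xi>. (\<Phi> p' \<xi> - \<Phi> p \<xi> - (fst (p' - p) * A \<xi> + snd (p' - p) * B \<xi>)) / norm (p' - p))
       (\<lambda>_. 0) (at p)"

text \<open>
  \<open>P i j\<close> is the partial derivative of order \<open>i\<close> in the first and \<open>j\<close> in the second variable.
\<close>

definition smooth_immersion_Linf :: "(real \<times> real) set \<Rightarrow> (real \<times> real \<Rightarrow> real \<Rightarrow> real) \<Rightarrow> bool" where
  "smooth_immersion_Linf D \<Phi> \<longleftrightarrow>
     (\<exists>P :: nat \<Rightarrow> nat \<Rightarrow> real \<times> real \<Rightarrow> real \<Rightarrow> real.
        P 0 0 = \<Phi> \<and>
        (\<forall>i j. \<forall>p\<in>D. P i j p \<in> borel_measurable (lebesgue_on {0..1}) \<and> bounded (P i j p ` {0..1}) \<and>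
           has_Linf_partials p (P i j) (P (Suc i) j p) (P i (Suc j) p)) \<and>
        (\<forall>p\<in>D. \<forall>u v. (\<forall>\<xi>\<in>{0..1}. u * P 1 0 p \<xi> + v * P 0 1 p \<xi> = 0) \<longrightarrow> u = 0 \<and> v = 0))"

text \<open>
  Near a state \<open>x\<close> the state space is a Banach manifold with chart \<open>h \<mapsto> x + h mod 2\<pi>\<close> for small
  \<open>h \<in> L\<^sup>\<infinity>([0,1], \<real>)\<close>. An embedded smooth surface is locally the homeomorphic image of an open
  subset of the plane under a map which is a smooth immersion in such a chart.
\<close>

definition embedded_smooth_surface :: "(real \<Rightarrow> angle) set \<Rightarrow> bool" where
  "embedded_smooth_surface W \<longleftrightarrow>
     W \<subseteq> mspace state_space \<and>
     (\<forall>x\<in>W. \<exists>U D \<Phi>.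
        openin (mtopology_of state_space) U \<and> x \<in> U \<and> open D \<and>
        smooth_immersion_Linf D \<Phi> \<and>
        homeomorphic_map (top_of_set D) (subtopology (mtopology_of state_space) (W \<inter> U))
          (\<lambda>p. \<lambda>\<xi>\<in>{0..1}. x \<xi> + to_angle (\<Phi> p \<xi>)))"


section \<open>The Ott-Antonsen densities\<close>

definition oa_density :: "real \<Rightarrow> real \<Rightarrow> real \<Rightarrow> real" where
  "oa_density \<alpha> \<beta> \<theta> = 1 / (2 * pi) * ((1 - \<beta>\<^sup>2) / (1 - 2 * \<beta> * cos (\<alpha> + \<theta>) + \<beta>\<^sup>2))"

definition oa_cdf :: "real \<Rightarrow> real \<Rightarrow> real \<Rightarrow> real" where
  "oa_cdf \<alpha> \<beta> \<theta> = integral {0..\<theta>} (oa_density \<alpha> \<beta>)"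

text \<open>
  The inverse of the bijection \<open>\<real>/2\<pi>\<int> \<rightarrow> \<real>/\<int>\<close> induced by the distribution function: the
  argument is read modulo \<open>1\<close>, and \<open>[0,2\<pi>)\<close> and \<open>[0,1)\<close> are fundamental domains.
\<close>

definition oa_cdf_inv :: "real \<Rightarrow> real \<Rightarrow> real \<Rightarrow> angle" where
  "oa_cdf_inv \<alpha> \<beta> s = to_angle (the_inv_into {0..<2 * pi} (oa_cdf \<alpha> \<beta>) (frac s))"

definition oa_shift :: "real \<Rightarrow> real \<Rightarrow> real" where
  "oa_shift \<alpha> \<beta> = - (1 / pi) * arctan (\<beta> * sin \<alpha> / (1 - \<beta> * cos \<alpha>))"

definition oa_state :: "real \<Rightarrow> real \<Rightarrow> real \<Rightarrow> real \<Rightarrow> angle" where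
  "oa_state q \<alpha> \<beta> = (\<lambda>\<xi>\<in>{0..1}. oa_cdf_inv \<alpha> \<beta> (\<xi> + oa_shift \<alpha> \<beta> + q / (2 * pi)))"

definition oa_manifold :: "(real \<Rightarrow> real) set" where
  "oa_manifold = {oa_density \<alpha> \<beta> | \<alpha> \<beta>. \<beta> \<in> {0..<1} \<and> \<alpha> \<in> {-pi..pi}}"

definition oa_parameter_solution :: "real set \<Rightarrow> (real \<Rightarrow> real) \<Rightarrow> (real \<Rightarrow> real) \<Rightarrow> bool" where
  "oa_parameter_solution T \<alpha> \<beta> \<longleftrightarrow>
     (\<forall>t\<in>T. \<beta> t \<in> {0..<1} \<and> \<alpha> t \<in> {-pi..pi} \<and>
        (\<beta> has_real_derivative 1 / 2 * \<beta> t * (1 - (\<beta> t)\<^sup>2)) (at t within T) \<and>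
        (\<alpha> has_real_derivative 0) (at t within T))"

definition mean_field_solution :: "real set \<Rightarrow> (real \<Rightarrow> real \<Rightarrow> real) \<Rightarrow> bool" where
  "mean_field_solution T f \<longleftrightarrow>
     (\<forall>t\<in>T. (\<forall>\<theta>. f t (\<theta> + 2 * pi) = f t \<theta>) \<and> f t absolutely_integrable_on {0..2 * pi} \<and>
        (\<forall>\<theta>. \<exists>D. ((\<lambda>s. f s \<theta>) has_real_derivative D) (at t within T) \<and>
           ((\<lambda>\<theta>. f t \<theta> * integral {0..2 * pi} (\<lambda>\<phi>. f t \<phi> * sin (\<theta> - \<phi>)))
              has_real_derivative D) (at \<theta>)))"

end

theory Submission
  imports Defs "HOL-Complex_Analysis.Cauchy_Integral_Formula"
begin

text \<open>
  Lift the circle to the unit circle of \<open>\<complex>\<close> and write \<open>w = cis x\<close>, \<open>v(\<xi>) = cis (2\<pi>\<xi> + q)\<close>. The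
  equation becomes the Riccati equation \<open>w' = (Z - w\<^sup>2 cnj Z) / 2\<close>, where \<open>Z\<close> is the mean of \<open>w\<close>.
  It preserves cross ratios, so a solution that tends to \<open>v\<close> as \<open>t \<rightarrow> -\<infinity>\<close> is at each time the image of
  \<open>v\<close> under a Moebius transformation preserving the circle. By the mean value property the first
  Fourier coefficient \<open>P\<close> of \<open>w\<close> then satisfies \<open>P' = - |Z|\<^sup>2 P\<close>; since \<open>P \<rightarrow> 1\<close>, it stays real and
  positive, which excludes orientation reversal and rotations and leaves \<open>w = (v + a) / (1 + cnj a v)\<close>
  with \<open>|a| < 1\<close>. Conversely these states evolve by \<open>a' = a (1 - |a|\<^sup>2) / 2\<close>. The angle of such a
  state is \<open>2\<pi>\<xi> + q + 2 Im (Ln (1 + a cnj v))\<close>, a single global chart of the manifold with inverse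
  \<open>x \<mapsto> Z\<close>; inverting the Moebius map gives the inverse of the Poisson kernel distribution function
  with \<open>a = \<beta> cis (-\<alpha>)\<close>.
\<close>

section \<open>Complex phases of states\<close>

text \<open>An element of the unstable manifold comes with a backward orbit and its limit, and the
  orbit has to be identified from these alone. The cross ratios supply a Moebius transformation
  separately for each time, with coefficients about whose dependence on t nothing is known. This is
  why \<open>P\<close> enters: it is an integral of the solution itself and can be differentiated in
  t. For the disc automorphism \<open>e (v + a) / (1 + cnj a v)\<close> with \<open>|e| = 1\<close>
  one has \<open>P = e (1 - |a|^2)\<close>, so the phase of \<open>P\<close> is the rotation
  \<open>e\<close>, and a real factor such as \<open>- |Z|^2\<close> cannot turn it. Cross ratios
  are conserved because differences of two solutions of the Riccati equation obey linear equations
  \<open>y' = c y\<close>, and the two products of differences that form a cross ratio share the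
  same \<open>c\<close>. In the explicit direction every estimate reduces to
  \<open>Ln (1 + a c)\<close> with \<open>|c| = 1\<close>, whose derivatives in \<open>a\<close> are
  bounded uniformly in \<open>c\<close>; this gives convergence in the sup norm.\<close>

lift_definition cis_angle :: "angle \<Rightarrow> complex" is cis
proof -
  fix a b :: real
  assume "cong_2pi a b"
  then obtain k :: int where "a - b = 2 * pi * of_int k"
    unfolding cong_2pi_def by blast
  then have "a = b + 2 * pi * of_int k" by simp
  then show "cis a = cis b" by (simp flip: cis_mult)
qed

lemma cis_angle_to_angle [simp]: "cis_angle (to_angle r) = cis r"
  by (fact cis_angle.abs_eq)

lemma to_angle_add: "to_angle (a + b) = to_angle a + to_angle b"
  by (simp add: plus_angle.abs_eq)

lemma cis_angle_add: "cis_angle (x + y) = cis_angle x * cis_angle y"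
  by transfer (simp add: cis_mult)

lemma norm_cis_angle [simp]: "norm (cis_angle x) = 1"
  by transfer simp

lemma cis_angle_eq_iff [simp]: "cis_angle x = cis_angle y \<longleftrightarrow> x = y"
proof
  show "cis_angle x = cis_angle y \<Longrightarrow> x = y"
  proof (transfer)
    fix a b :: real
    assume "cis a = cis b"
    then have "exp (\<i> * complex_of_real a) = exp (\<i> * complex_of_real b)"
      by (simp add: cis_conv_exp)
    then obtain n :: int where "\<i> * complex_of_real a = \<i> * complex_of_real b + (2 * of_int n * pi) * \<i>"
      unfolding exp_eq by auto
    then have "\<i> * complex_of_real a = \<i> * complex_of_real (b + 2 * of_int n * pi)"
      by (simp add: algebra_simps)
    then have "a = b + 2 * of_int n * pi"
      by (simp only: mult_cancel_left of_real_eq_iff) simp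
    then show "cong_2pi a b"
      unfolding cong_2pi_def by (intro exI[of _ n]) simp
  qed
qed simp

lemma sin_angle_diff: "sin_angle (x - y) = Im (cis_angle x * cnj (cis_angle y))"
  unfolding minus_angle_def
  by transfer (simp add: sin_diff mult.commute)

lemma dist_to_angle_le: "dist (to_angle a) (to_angle b) \<le> \<bar>a - b\<bar>"
  using INF_dist_lattice_le[of "a - b" 0] by (simp add: dist_angle.abs_eq)

lemma norm_cis_diff_le: "norm (cis a - cis b) \<le> \<bar>a - b\<bar>"
proof -
  have "cis a - cis b = cis b * (cis (a - b) - 1)"
    by (simp add: algebra_simps cis_mult)
  then have "norm (cis a - cis b) = norm (cis (a - b) - 1)"
    by (simp add: norm_mult)
  also have "\<dots> \<le> \<bar>a - b\<bar>"
    using dist_exp_i_1[of "a - b"] abs_sin_x_le_abs_x[of "(a - b) / 2"]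
    by (simp add: cis_conv_exp)
  finally show ?thesis .
qed

lemma norm_cis_angle_diff_le: "norm (cis_angle x - cis_angle y) \<le> dist x y"
proof transfer
  fix a b :: real
  \<comment> \<open>The nearest multiple of 2 pi attains the infimum that defines
    \<open>dist\<close>, so the chord is compared with the shortest arc.\<close>
  define k where "k = round ((a - b) / (2 * pi))"
  have "cis a = cis (a - 2 * pi * of_int k)"
    by (simp flip: cis_divide)
  then have "norm (cis a - cis b) \<le> \<bar>a - 2 * pi * of_int k - b\<bar>"
    by (metis norm_cis_diff_le)
  also have "\<dots> = (INF k::int. \<bar>a - b - 2 * pi * of_int k\<bar>)"
    unfolding INF_dist_lattice k_def by (simp add: algebra_simps)
  finally show "norm (cis a - cis b) \<le> (INF k::int. \<bar>a - b - 2 * pi * of_int k\<bar>)" .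
qed

lemma continuous_on_cis_angle: "continuous_on A cis_angle"
  unfolding continuous_on_iff
  by (metis dist_norm norm_cis_angle_diff_le order.strict_trans1)

lemma continuous_on_to_angle: "continuous_on A to_angle"
  unfolding continuous_on_iff
  by (metis dist_real_def dist_to_angle_le order.strict_trans1)

text \<open>Rounding leaves at most half a period. Hence every circle-valued function is bounded in
  the uniform metric, and membership in \<open>state_space\<close> reduces to measurability and the
  convention outside the interval.\<close>

lemma dist_angle_le_pi: "dist (x::angle) y \<le> pi"
proof transfer
  fix a b :: real
  have "\<bar>(a - b) - 2 * pi * of_int (round ((a - b) / (2 * pi)))\<bar>
      = 2 * pi * \<bar>(a - b) / (2 * pi) - of_int (round ((a - b) / (2 * pi)))\<bar>"
  proof -
    have "(a - b) - 2 * pi * of_int m = 2 * pi * ((a - b) / (2 * pi) - of_int m)" for m :: int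
      by (simp add: field_simps)
    then show ?thesis by (simp add: abs_mult)
  qed
  also have "\<dots> \<le> 2 * pi * (1 / 2)"
    using of_int_round_abs_le[of "(a - b) / (2 * pi)"]
    by (intro mult_left_mono) (auto simp: abs_minus_commute)
  finally show "(INF k::int. \<bar>a - b - 2 * pi * of_int k\<bar>) \<le> pi"
    by (simp add: INF_dist_lattice)
qed

section \<open>States, uniform distance and the order parameter\<close>

lemma mem_state_space_iff:
  "x \<in> mspace state_space \<longleftrightarrow>
     x \<in> extensional {0..1} \<and> x \<in> borel_measurable (lebesgue_on {0..1})"
proof -
  have "Metric_space.mbounded UNIV dist (x ` {0..1})"
    unfolding Met_TC.mbounded_alt by (auto intro!: exI[of _ pi] dist_angle_le_pi)
  then show ?thesis
    by (auto simp: state_space_def Met_TC.fspace_def)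
qed

lemma mdist_state_space_le_iff:
  assumes "x \<in> mspace state_space" "y \<in> mspace state_space"
  shows "mdist state_space x y \<le> r \<longleftrightarrow> (\<forall>\<xi>\<in>{0..1}. dist (x \<xi>) (y \<xi>) \<le> r)"
  using assms funspace_mdist_le[of x "{0..1::real}" euclidean_metric y r]
  by (simp add: state_space_def)

lemma dist_le_mdist_state_space:
  assumes "x \<in> mspace state_space" "y \<in> mspace state_space" "\<xi> \<in> {0..1}"
  shows "dist (x \<xi>) (y \<xi>) \<le> mdist state_space x y"
  using mdist_state_space_le_iff[OF assms(1,2), of "mdist state_space x y"] assms(3) by simp

lemma integrable_on_of_bounded_measurable:
  fixes f :: "real \<Rightarrow> 'b::euclidean_space"
  assumes "f \<in> borel_measurable (lebesgue_on {0..1})" "\<And>\<xi>. \<xi> \<in> {0..1} \<Longrightarrow> norm (f \<xi>) \<le> B"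
  shows "f integrable_on {0..1}"
  by (rule measurable_bounded_by_integrable_imp_integrable[of _ _ "\<lambda>_. B"]) (use assms in auto)

lemma cis_angle_state_measurable:
  assumes "x \<in> mspace state_space"
  shows "(\<lambda>\<xi>. cis_angle (x \<xi>)) \<in> borel_measurable (lebesgue_on {0..1})"
proof (rule measurable_compose[where f = x and g = cis_angle])
  show "x \<in> borel_measurable (lebesgue_on {0..1})"
    using assms by (simp add: mem_state_space_iff)
  show "cis_angle \<in> borel_measurable borel"
    by (intro borel_measurable_continuous_onI continuous_on_cis_angle)
qed

lemma cis_angle_state_integrable:
  assumes "x \<in> mspace state_space"
  shows "(\<lambda>\<xi>. cis_angle (x \<xi>)) integrable_on {0..1}"
  by (rule integrable_on_of_bounded_measurable[OF cis_angle_state_measurable[OF assms], of 1]) simp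

definition order_parameter :: "(real \<Rightarrow> angle) \<Rightarrow> complex" where
  "order_parameter x = integral {0..1} (\<lambda>\<xi>. cis_angle (x \<xi>))"

text \<open>The sine of a phase difference is the imaginary part of a product in which only one
  factor depends on the integration variable, so each point feels the others only through their
  mean.\<close>

lemma kuramoto_rhs_eq:
  assumes "x \<in> mspace state_space"
  shows "kuramoto_rhs x \<xi> = Im (order_parameter x * cnj (cis_angle (x \<xi>)))"
proof -
  have "((\<lambda>z. cis_angle (x z)) has_integral order_parameter x) {0..1}"
    unfolding order_parameter_def using cis_angle_state_integrable[OF assms]
    by (rule integrable_integral)
  then have "((\<lambda>z. cis_angle (x z) * cnj (cis_angle (x \<xi>))) has_integral
      order_parameter x * cnj (cis_angle (x \<xi>))) {0..1}"
    by (rule has_integral_mult_left)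
  then have "((\<lambda>z. Im (cis_angle (x z) * cnj (cis_angle (x \<xi>)))) has_integral
      Im (order_parameter x * cnj (cis_angle (x \<xi>)))) {0..1}"
    by (drule_tac has_integral_linear[OF _ bounded_linear_Im]) (simp only: o_def)
  then show ?thesis
    by (simp add: kuramoto_rhs_def sin_angle_diff integral_unique)
qed

lemma norm_order_parameter_le: "norm (order_parameter x) \<le> 1"
proof (cases "(\<lambda>\<xi>. cis_angle (x \<xi>)) integrable_on {0..1}")
  case True
  then show ?thesis
    using has_integral_bound[of 1 "\<lambda>\<xi>. cis_angle (x \<xi>)" "order_parameter x" 0 1]
    by (simp add: order_parameter_def has_integral_integrable_integral)
next
  case False
  then show ?thesis by (simp add: order_parameter_def not_integrable_integral)
qed

text \<open>Chords are no longer than arcs. The resulting continuity of the order parameter is what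
  makes it a continuous inverse of the chart.\<close>

lemma order_parameter_dist_le:
  assumes "x \<in> mspace state_space" "y \<in> mspace state_space"
  shows "norm (order_parameter x - order_parameter y) \<le> mdist state_space x y"
proof -
  have "((\<lambda>\<xi>. cis_angle (x \<xi>) - cis_angle (y \<xi>)) has_integral
      order_parameter x - order_parameter y) (cbox 0 1)"
    unfolding order_parameter_def
    using cis_angle_state_integrable assms by (intro has_integral_diff integrable_integral) auto
  moreover have "norm (cis_angle (x \<xi>) - cis_angle (y \<xi>)) \<le> mdist state_space x y"
    if "\<xi> \<in> cbox 0 1" for \<xi>
    using norm_cis_angle_diff_le[of "x \<xi>" "y \<xi>"] dist_le_mdist_state_space[OF assms, of \<xi>] that
    by simp
  moreover have "0 \<le> mdist state_space x y"
    by simp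
  ultimately have "norm (order_parameter x - order_parameter y)
      \<le> mdist state_space x y * measure lborel (cbox 0 (1::real))"
    by (intro has_integral_bound[where f = "\<lambda>\<xi>. cis_angle (x \<xi>) - cis_angle (y \<xi>)"])
  then show ?thesis by simp
qed

lemma limitin_state_space_iff:
  assumes "y \<in> mspace state_space"
  shows "limitin (mtopology_of state_space) x y F \<longleftrightarrow>
    (\<forall>\<epsilon>>0. \<forall>\<^sub>F t in F. x t \<in> mspace state_space \<and> mdist state_space (x t) y < \<epsilon>)"
  using assms Metric_space.limitin_metric[OF Metric_space_mspace_mdist[of state_space], of x y F]
  by (simp add: mtopology_of_def)

section \<open>Means over the circle\<close>

definition circle_point :: "real \<Rightarrow> real \<Rightarrow> complex" where
  "circle_point q \<xi> = cis (2 * pi * \<xi> + q)"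

lemma norm_circle_point [simp]: "norm (circle_point q \<xi>) = 1"
  by (simp add: circle_point_def)

lemma circle_point_nonzero [simp]: "circle_point q \<xi> \<noteq> 0"
  by (simp add: circle_point_def)

lemma circle_point_mult_cnj [simp]:
  "circle_point q \<xi> * cnj (circle_point q \<xi>) = 1" "cnj (circle_point q \<xi>) * circle_point q \<xi> = 1"
  by (simp_all add: complex_norm_square[symmetric] mult.commute)

lemma cnj_circle_point: "cnj (circle_point q \<xi>) = 1 / circle_point q \<xi>"
  by (simp add: field_simps)

lemma circle_point_eq_exp: "circle_point q \<xi> = cis q * exp (2 * of_real pi * \<i> * of_real \<xi>)"
  by (simp add: circle_point_def cis_conv_exp exp_add[symmetric] algebra_simps)

lemma continuous_on_circle_point [continuous_intros]: "continuous_on A (circle_point q)"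
  unfolding circle_point_def by (intro continuous_intros)

lemma circle_point_surj:
  assumes "norm c = 1"
  obtains \<xi> where "\<xi> \<in> {0..1}" "circle_point q \<xi> = c"
proof -
  define \<xi> where "\<xi> = frac ((Arg c - q) / (2 * pi))"
  have "\<xi> \<in> {0..1}"
    by (simp add: \<xi>_def frac_ge_0 less_imp_le[OF frac_lt_1])
  have "2 * pi * \<xi> + q = Arg c - 2 * pi * of_int \<lfloor>(Arg c - q) / (2 * pi)\<rfloor>"
    by (simp add: \<xi>_def frac_def field_simps)
  then have "circle_point q \<xi> = cis (Arg c)"
    by (simp add: circle_point_def flip: cis_divide)
  also have "\<dots> = c"
    using assms cis_Arg[of c] by (cases "c = 0") (auto simp: sgn_div_norm)
  finally show ?thesis using that \<open>\<xi> \<in> {0..1}\<close> by blast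
qed

text \<open>The velocity of \<open>circlepath 0 1\<close> is \<open>2 * pi * \<i>\<close> times the
  point itself; this accounts for the normalization and for the extra exponential factor.\<close>

lemma circle_contour_integral:
  assumes "((\<lambda>u. f u) has_contour_integral I) (circlepath 0 1)"
  shows "((\<lambda>\<xi>. f (exp (2 * of_real pi * \<i> * of_real \<xi>)) * exp (2 * of_real pi * \<i> * of_real \<xi>))
    has_integral I / (2 * pi * \<i>)) {0..1}"
proof -
  have "((\<lambda>\<xi>. f (circlepath 0 1 \<xi>) * vector_derivative (circlepath 0 1) (at \<xi> within {0..1}))
      has_integral I) {0..1}"
    using assms by (simp add: has_contour_integral_def)
  then have "((\<lambda>\<xi>. f (circlepath 0 1 \<xi>) * vector_derivative (circlepath 0 1) (at \<xi> within {0..1})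
      / (2 * pi * \<i>)) has_integral I / (2 * pi * \<i>)) {0..1}"
    by (rule has_integral_divide)
  then show ?thesis
  proof (rule has_integral_eq[rotated])
    fix \<xi> :: real assume "\<xi> \<in> {0..1}"
    then show "f (circlepath 0 1 \<xi>) * vector_derivative (circlepath 0 1) (at \<xi> within {0..1}) / (2 * pi * \<i>)
        = f (exp (2 * of_real pi * \<i> * of_real \<xi>)) * exp (2 * of_real pi * \<i> * of_real \<xi>)"
      using vector_derivative_circlepath01[of \<xi> 0 1]
      by (simp add: circlepath del: times_divide_eq_left) (simp add: field_simps)
  qed
qed

text \<open>Cauchy's formula at the centre, for f precomposed with the rotation by q. Holomorphy is
  asked for on the open ball, with continuity up to the circle, because the reflection in
  \<open>circle_mean_cnj\<close> works with open sets.\<close>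

lemma circle_mean_ball:
  assumes "continuous_on (cball 0 1) f" "f holomorphic_on ball 0 1"
  shows "((\<lambda>\<xi>. f (circle_point q \<xi>)) has_integral f 0) {0..1}"
proof -
  have "continuous_on (cball 0 1) (\<lambda>u. f (cis q * u))"
    by (rule continuous_on_compose2[OF assms(1)]) (auto intro!: continuous_intros simp: norm_mult)
  moreover have "(f \<circ> (\<lambda>u. cis q * u)) holomorphic_on ball 0 1"
    by (rule holomorphic_on_compose_gen[OF _ assms(2)])
       (auto intro!: holomorphic_intros simp: norm_mult)
  then have "(\<lambda>u. f (cis q * u)) holomorphic_on ball 0 1" by (simp add: o_def)
  ultimately have "((\<lambda>u. f (cis q * u) / (u - 0)) has_contour_integral
      2 * of_real pi * \<i> * f (cis q * 0)) (circlepath 0 1)"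
    by (rule Cauchy_integral_circlepath) simp
  from circle_contour_integral[OF this] show ?thesis
    by (simp add: circle_point_eq_exp)
qed

lemma circle_mean:
  assumes "f holomorphic_on cball 0 1"
  shows "((\<lambda>\<xi>. f (circle_point q \<xi>)) has_integral f 0) {0..1}"
  using assms
  by (intro circle_mean_ball holomorphic_on_imp_continuous_on holomorphic_on_subset[OF _ ball_subset_cball])

text \<open>By reflection, \<open>\<lambda>u. cnj (f (cnj u))\<close> is again holomorphic, and its
  mean over the circle is the conjugate of the wanted one.\<close>

lemma circle_mean_cnj:
  assumes "f holomorphic_on cball 0 1"
  shows "((\<lambda>\<xi>. f (cnj (circle_point q \<xi>))) has_integral f 0) {0..1}"
proof -
  have cont: "continuous_on (cball 0 1) (\<lambda>u. cnj (f (cnj u)))"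
    by (intro continuous_on_cnj continuous_on_compose2[OF holomorphic_on_imp_continuous_on[OF assms]])
      (auto intro!: continuous_intros)
  have img: "cnj ` ball 0 1 = ball 0 1"
    by (auto simp: image_iff intro!: bexI[of _ "cnj _"])
  have "(cnj \<circ> f \<circ> cnj) holomorphic_on ball 0 1"
    using assms by (intro holomorphic_on_compose_cnj_cnj)
      (auto simp: img intro: holomorphic_on_subset[OF _ ball_subset_cball])
  then have "((\<lambda>\<xi>. cnj (f (cnj (circle_point q \<xi>)))) has_integral cnj (f (cnj 0))) {0..1}"
    by (intro circle_mean_ball cont) (simp add: o_def)
  from has_integral_linear[OF this bounded_linear_cnj]
  show ?thesis by (simp add: o_def)
qed

text \<open>Cauchy's formula for the first coefficient is the mean value property of the difference
  quotient \<open>(f u - f 0) / u\<close>.\<close>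

lemma circle_mean_first_coefficient:
  assumes "g holomorphic_on cball 0 1" "\<And>u. norm u = 1 \<Longrightarrow> f u = f0 + u * g u"
  shows "((\<lambda>\<xi>. f (circle_point q \<xi>) * cnj (circle_point q \<xi>)) has_integral g 0) {0..1}"
proof -
  have "((\<lambda>\<xi>. f0 * cnj (circle_point q \<xi>) + g (circle_point q \<xi>)) has_integral f0 * 0 + g 0) {0..1}"
    by (intro has_integral_add has_integral_mult_right circle_mean[OF assms(1)]
        circle_mean_cnj[of "\<lambda>u. u"]) (auto intro: holomorphic_intros)
  then show ?thesis
    by (rule has_integral_eq_rhs[OF has_integral_eq[rotated]])
      (simp_all add: assms(2) cnj_circle_point field_simps)
qed

section \<open>Derivatives of \<open>Ln (1 + a * c)\<close> in \<open>a\<close>\<close>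

text \<open>The n-th derivative in \<open>a\<close>, in closed form: smoothness of the surface
  involves every order, and the formula yields bounds that do not depend on the unimodular number
  \<open>c\<close>.\<close>

primrec ln_jet :: "complex \<Rightarrow> nat \<Rightarrow> complex \<Rightarrow> complex" where
  "ln_jet c 0 a = Ln (1 + a * c)"
| "ln_jet c (Suc n) a = (- 1) ^ n * fact n * c ^ Suc n / (1 + a * c) ^ Suc n"

lemma norm_one_plus_mult_ge:
  fixes a c :: complex
  assumes "norm a \<le> r" "norm c = 1"
  shows "1 - r \<le> norm (1 + a * c)"
  using assms norm_triangle_ineq2[of 1 "- (a * c)"] by (simp add: norm_mult)

text \<open>Staying in the right half-plane keeps \<open>1 + a * c\<close> off the branch cut, so
  the principal logarithm is holomorphic in \<open>a\<close> and does not jump as \<open>c\<close>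
  runs around the circle.\<close>

lemma Re_one_plus_mult_pos:
  fixes a c :: complex
  assumes "norm a < 1" "norm c = 1"
  shows "0 < Re (1 + a * c)"
  using assms abs_Re_le_cmod[of "a * c"] by (simp add: norm_mult)

lemma ln_jet_deriv:
  assumes "norm a < 1" "norm c = 1"
  shows "(ln_jet c n has_field_derivative ln_jet c (Suc n) a) (at a within A)"
proof -
  have pos: "0 < Re (1 + a * c)"
    by (rule Re_one_plus_mult_pos[OF assms])
  then have nz: "1 + a * c \<noteq> 0" by force
  show ?thesis
  proof (cases n)
    case 0
    have "(\<lambda>a. Ln (1 + a * c)) = ln_jet c 0" by auto
    moreover have "((\<lambda>a. Ln (1 + a * c)) has_field_derivative c / (1 + a * c)) (at a within A)"
      using pos by (auto intro!: derivative_eq_intros simp: complex_nonpos_Reals_iff divide_inverse mult.commute)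
    ultimately show ?thesis by (simp add: 0)
  next
    case (Suc m)
    have eq: "ln_jet c (Suc m) = (\<lambda>a. (- 1) ^ m * fact m * c ^ Suc m / (1 + a * c) ^ Suc m)"
      by (rule ext) simp
    have "((\<lambda>a. (- 1) ^ m * fact m * c ^ Suc m / (1 + a * c) ^ Suc m) has_field_derivative
        - ((- 1) ^ m * fact m * c ^ Suc m) * (of_nat (Suc m) * (1 + a * c) ^ m * c)
          / ((1 + a * c) ^ Suc m * (1 + a * c) ^ Suc m)) (at a within A)"
    proof -
      have "((\<lambda>a. (1 + a * c) ^ Suc m) has_field_derivative of_nat (Suc m) * (1 + a * c) ^ m * c)
          (at a within A)"
        by (rule DERIV_cong[OF DERIV_power]) (auto intro!: derivative_eq_intros)
      moreover have "(1 + a * c) ^ Suc m \<noteq> 0"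
        using nz by simp
      ultimately show ?thesis
        by (auto dest: DERIV_divide[OF DERIV_const] elim!: DERIV_cong simp del: power_Suc)
    qed
    moreover have "- ((- 1) ^ m * fact m * c ^ Suc m) * (of_nat (Suc m) * (1 + a * c) ^ m * c)
          / ((1 + a * c) ^ Suc m * (1 + a * c) ^ Suc m) = ln_jet c (Suc (Suc m)) a"
      using nz by (simp add: divide_simps)
    ultimately show ?thesis by (simp only: Suc eq)
  qed
qed

lemma norm_ln_jet_le:
  assumes "norm a \<le> r" "r < 1" "norm c = 1"
  shows "norm (ln_jet c (Suc n) a) \<le> fact n / (1 - r) ^ Suc n"
proof -
  have "(1 - r) ^ Suc n \<le> norm (1 + a * c) ^ Suc n"
    using assms norm_one_plus_mult_ge[of a r c] by (intro power_mono) auto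
  moreover have "0 < (1 - r) ^ Suc n"
    using assms by (intro zero_less_power) simp
  moreover have "norm (ln_jet c (Suc n) a) = fact n / norm (1 + a * c) ^ Suc n"
    using assms by (simp add: norm_mult norm_divide norm_power del: power_Suc)
  ultimately show ?thesis
    by (simp only:) (intro divide_left_mono mult_pos_pos; linarith?; simp)
qed

text \<open>Taylor's formula of order one on the ball of radius r, where \<open>1 + a * c\<close>
  keeps distance \<open>1 - r\<close> from 0. The constant is free of \<open>c\<close>, hence
  uniform in \<xi>; both the time derivative and the Frechet derivatives of the chart rest on
  this.\<close>

lemma ln_jet_Taylor:
  assumes "norm a \<le> r" "norm b \<le> r" "r < 1" "norm c = 1"
  shows "norm (ln_jet c n b - ln_jet c n a - ln_jet c (Suc n) a * (b - a))
    \<le> fact (Suc n) / (1 - r) ^ Suc (Suc n) * norm (b - a) ^ 2"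
proof -
  have "norm (ln_jet c (n + 0) b - (\<Sum>i\<le>1. ln_jet c (n + i) a * (b - a) ^ i / fact i))
      \<le> fact (Suc n) / (1 - r) ^ Suc (Suc n) * norm (b - a) ^ Suc 1 / fact 1"
  proof (rule complex_Taylor[where f = "\<lambda>i. ln_jet c (n + i)" and S = "cball 0 r"])
    show "(ln_jet c (n + i) has_field_derivative ln_jet c (n + Suc i) x) (at x within cball 0 r)"
      if "x \<in> cball 0 r" for i x
      using ln_jet_deriv[of x c "n + i" "cball 0 r"] that assms by simp
    show "norm (ln_jet c (n + Suc 1) x) \<le> fact (Suc n) / (1 - r) ^ Suc (Suc n)" if "x \<in> cball 0 r" for x
      using norm_ln_jet_le[of x r c "Suc n"] that assms by simp
  qed (use assms in auto)
  then show ?thesis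
    by (simp add: power2_eq_square algebra_simps)
qed

lemma ln_jet_Lipschitz:
  assumes "norm a \<le> r" "norm b \<le> r" "r < 1" "norm c = 1"
  shows "norm (ln_jet c n b - ln_jet c n a) \<le> fact n / (1 - r) ^ Suc n * norm (b - a)"
proof (rule field_differentiable_bound[of "cball 0 r" _ "ln_jet c (Suc n)"])
  show "(ln_jet c n has_field_derivative ln_jet c (Suc n) x) (at x within cball 0 r)"
    if "x \<in> cball 0 r" for x
    using ln_jet_deriv[of x c] that assms by simp
  show "norm (ln_jet c (Suc n) x) \<le> fact n / (1 - r) ^ Suc n" if "x \<in> cball 0 r" for x
    using norm_ln_jet_le[of x r c n] that assms by simp
qed (use assms in auto)

lemma continuous_on_ln_jet:
  assumes "norm a < 1"
  shows "continuous_on A (\<lambda>\<xi>. ln_jet (cnj (circle_point q \<xi>)) n a)"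
proof -
  have "0 < Re (1 + a * cnj (circle_point q \<xi>))" for \<xi>
    by (rule Re_one_plus_mult_pos) (use assms in auto)
  then have slit: "1 + a * cnj (circle_point q \<xi>) \<notin> \<real>\<^sub>\<le>\<^sub>0" for \<xi>
    by (simp only: complex_nonpos_Reals_iff not_le de_Morgan_conj simp_thms)
  then have "1 + a * cnj (circle_point q \<xi>) \<noteq> 0" for \<xi>
    by (metis nonpos_Reals_zero_I)
  with slit show ?thesis
    by (cases n) (auto intro!: continuous_intros simp del: power_Suc)
qed

section \<open>Moebius images of the twisted state\<close>

text \<open>With \<open>u = 1 + a * cnj v\<close> the Moebius image
  \<open>(v + a) / (1 + cnj a * v)\<close> equals \<open>v * u / cnj u\<close>, and dividing by the
  conjugate doubles the argument of u. The lift is therefore a real angle of the image, not reduced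
  modulo 2 pi.\<close>

definition disc_lift :: "real \<Rightarrow> complex \<Rightarrow> real \<Rightarrow> real" where
  "disc_lift q a \<xi> = 2 * pi * \<xi> + q + 2 * Im (ln_jet (cnj (circle_point q \<xi>)) 0 a)"

definition disc_state :: "real \<Rightarrow> complex \<Rightarrow> real \<Rightarrow> angle" where
  "disc_state q a = (\<lambda>\<xi>\<in>{0..1}. to_angle (disc_lift q a \<xi>))"

lemma disc_state_apply: "\<xi> \<in> {0..1} \<Longrightarrow> disc_state q a \<xi> = to_angle (disc_lift q a \<xi>)"
  by (simp add: disc_state_def)

lemma disc_state_0: "disc_state q 0 = twisted_state q"
  by (simp add: disc_state_def twisted_state_def disc_lift_def)

lemma disc_state_mem:
  assumes "norm a < 1"
  shows "disc_state q a \<in> mspace state_space"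
proof -
  have "continuous_on {0..1} (disc_lift q a)"
    unfolding disc_lift_def by (intro continuous_intros continuous_on_ln_jet assms)
  then have "(\<lambda>\<xi>. to_angle (disc_lift q a \<xi>)) \<in> borel_measurable (lebesgue_on {0..1})"
    by (intro continuous_imp_measurable_on_sets_lebesgue continuous_on_compose2[OF continuous_on_to_angle[of UNIV]]) auto
  moreover have "disc_state q a \<in> borel_measurable (lebesgue_on {0..1}) \<longleftrightarrow>
      (\<lambda>\<xi>. to_angle (disc_lift q a \<xi>)) \<in> borel_measurable (lebesgue_on {0..1})"
    by (rule measurable_cong) (auto simp: disc_state_def)
  ultimately show ?thesis
    by (simp add: mem_state_space_iff disc_state_def)
qed

lemma cis_2_Im_Ln:
  assumes "u \<noteq> 0"
  shows "cis (2 * Im (Ln u)) = u / cnj u"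
proof -
  have "cis (2 * Im (Ln u)) = exp (Ln u - cnj (Ln u))"
    by (simp add: cis_conv_exp complex_diff_cnj mult.commute)
  also have "\<dots> = u / cnj u"
    using assms by (simp add: exp_diff flip: exp_cnj)
  finally show ?thesis .
qed

lemma disc_denominator_nonzero:
  fixes a z :: complex
  assumes "norm a < 1" "norm z \<le> 1"
  shows "1 + a * z \<noteq> 0"
proof
  assume "1 + a * z = 0"
  then have "a * z = - 1" by (simp add: add_eq_0_iff)
  then have "norm a * norm z = 1" by (metis norm_minus_cancel norm_mult norm_one)
  then show False
    using assms mult_left_le[of "norm z" "norm a"] by simp
qed

lemma cis_disc_state:
  fixes q :: real
  assumes "norm a < 1" "\<xi> \<in> {0..1}"
  defines "v \<equiv> circle_point q \<xi>"
  shows "cis_angle (disc_state q a \<xi>) = (v + a) / (1 + cnj a * v)"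
proof -
  have nz: "1 + a * cnj v \<noteq> 0"
    using disc_denominator_nonzero[of a "cnj v"] assms(1) by (simp add: v_def)
  have "cis_angle (disc_state q a \<xi>) = v * cis (2 * Im (Ln (1 + a * cnj v)))"
    using assms(2) by (simp add: disc_state_apply disc_lift_def v_def circle_point_def cis_mult)
  also have "\<dots> = (v + a * (v * cnj v)) / (1 + cnj a * v)"
    using nz by (simp add: cis_2_Im_Ln algebra_simps)
  finally show ?thesis by (simp add: v_def)
qed

text \<open>The pole of the Moebius map lies outside the closed disc, so its mean over the circle is
  its value at the centre.\<close>

lemma order_parameter_disc_state:
  assumes "norm a < 1"
  shows "order_parameter (disc_state q a) = a"
proof -
  have "(\<lambda>z. (z + a) / (1 + cnj a * z)) holomorphic_on cball 0 1"
    using assms disc_denominator_nonzero[of "cnj a"] by (intro holomorphic_intros) auto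
  from circle_mean[OF this, of q] have "((\<lambda>\<xi>. cis_angle (disc_state q a \<xi>)) has_integral a) {0..1}"
    by (rule has_integral_eq_rhs[OF has_integral_eq[rotated]])
      (simp_all add: cis_disc_state[OF assms])
  then show ?thesis
    by (simp add: order_parameter_def integral_unique)
qed

lemma mdist_disc_state_le:
  assumes "norm a \<le> r" "norm b \<le> r" "r < 1"
  shows "mdist state_space (disc_state q a) (disc_state q b) \<le> 2 / (1 - r) * norm (a - b)"
proof (subst mdist_state_space_le_iff)
  show "disc_state q a \<in> mspace state_space" "disc_state q b \<in> mspace state_space"
    using assms by (auto intro: disc_state_mem)
  show "\<forall>\<xi>\<in>{0..1}. dist (disc_state q a \<xi>) (disc_state q b \<xi>) \<le> 2 / (1 - r) * norm (a - b)"
  proof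
    fix \<xi> :: real assume \<xi>: "\<xi> \<in> {0..1}"
    define c where "c = cnj (circle_point q \<xi>)"
    have "dist (disc_state q a \<xi>) (disc_state q b \<xi>) \<le> \<bar>disc_lift q a \<xi> - disc_lift q b \<xi>\<bar>"
      using \<xi> by (simp add: disc_state_apply dist_to_angle_le)
    also have "\<dots> = 2 * \<bar>Im (ln_jet c 0 a - ln_jet c 0 b)\<bar>"
    proof -
      have "disc_lift q a \<xi> - disc_lift q b \<xi> = 2 * Im (ln_jet c 0 a - ln_jet c 0 b)"
        by (simp add: disc_lift_def c_def del: ln_jet.simps)
      then show ?thesis by (simp only: abs_mult abs_numeral)
    qed
    also have "\<dots> \<le> 2 * (fact 0 / (1 - r) ^ Suc 0 * norm (a - b))"
      using ln_jet_Lipschitz[of b r a c 0] assms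
      by (intro mult_left_mono order.trans[OF abs_Im_le_cmod]) (auto simp: c_def simp del: ln_jet.simps)
    finally show "dist (disc_state q a \<xi>) (disc_state q b \<xi>) \<le> 2 / (1 - r) * norm (a - b)"
      by simp
  qed
qed

text \<open>The right-hand side is the chain rule for \<open>disc_lift\<close> when \<open>a\<close>
  moves with velocity \<open>a (1 - |a|^2) / 2\<close>. Thus the infinite-dimensional vector field
  is tangent to the family of Moebius states.\<close>

lemma kuramoto_rhs_disc_state:
  assumes "norm a < 1" "\<xi> \<in> {0..1}"
  shows "kuramoto_rhs (disc_state q a) \<xi> =
    2 * Im (ln_jet (cnj (circle_point q \<xi>)) 1 a * (a * of_real (1 - (norm a)\<^sup>2) / 2))"
proof -
  define v where "v = circle_point q \<xi>"
  define z where "z = a * cnj v"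
  have nz: "1 + z \<noteq> 0"
    using disc_denominator_nonzero[of a "cnj v"] assms(1) by (simp add: v_def z_def)
  have "norm z = norm a"
    by (simp add: z_def v_def norm_mult)
  then have norm_z: "of_real ((norm a)\<^sup>2) = z * cnj z"
    by (metis complex_norm_square)
  have "cnj (cis_angle (disc_state q a \<xi>)) = (cnj v + cnj a) / (1 + z)"
    using assms by (simp add: cis_disc_state v_def z_def)
  also have "cnj v + cnj a = cnj v * (1 + cnj z)"
    by (simp add: z_def v_def algebra_simps)
  finally have "kuramoto_rhs (disc_state q a) \<xi> = Im (z * (1 + cnj z) / (1 + z))"
    using assms by (simp add: kuramoto_rhs_eq disc_state_mem order_parameter_disc_state z_def mult.assoc)
  \<comment> \<open>The two expressions differ by \<open>z * cnj z\<close>, which is real and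
    disappears under \<open>Im\<close>.\<close>
  also have "z * (1 + cnj z) / (1 + z) = z * (1 - z * cnj z) / (1 + z) + z * cnj z"
    using nz by (simp add: field_simps)
  also have "Im \<dots> = Im (z * (1 - z * cnj z) / (1 + z))"
    by simp
  also have "\<dots> = 2 * Im (ln_jet (cnj v) 1 a * (a * (1 - z * cnj z) / 2))"
  proof -
    have J: "ln_jet (cnj v) 1 a = cnj v / (1 + z)"
      by (simp add: z_def)
    have half: "2 * (k * (y / 2)) = y * k" for k y :: complex
      by simp
    have "a * cnj v * (1 - w) / (1 + z) = 2 * (ln_jet (cnj v) 1 a * (a * (1 - w) / 2))" for w
      unfolding J half by (simp add: mult_ac)
    then have "Im (z * (1 - w) / (1 + z)) = Im (2 * (ln_jet (cnj v) 1 a * (a * (1 - w) / 2)))" for w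
      by (simp only: z_def)
    then show ?thesis by (simp only: mult_2 plus_complex.sel)
  qed
  finally show ?thesis
    by (simp add: norm_z v_def of_real_diff del: of_real_power)
qed

lemma kuramoto_solution_disc_state:
  assumes norm_a: "\<And>t. t \<in> T \<Longrightarrow> norm (a t) < 1"
    and deriv: "\<And>t. t \<in> T \<Longrightarrow>
      (a has_vector_derivative a t * of_real (1 - (norm (a t))\<^sup>2) / 2) (at t within T)"
  shows "kuramoto_solution T (\<lambda>t. disc_state q (a t))"
  unfolding kuramoto_solution_def
proof (intro ballI conjI)
  fix t assume t: "t \<in> T"
  show "disc_state q (a t) \<in> mspace state_space"
    by (rule disc_state_mem[OF norm_a[OF t]])
  define a' where "a' = a t * of_real (1 - (norm (a t))\<^sup>2) / 2"
  define J where "J \<xi> = ln_jet (cnj (circle_point q \<xi>))" for \<xi>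
  \<comment> \<open>The midpoint leaves room: for s near t also \<open>a s\<close> lies in the ball
    of radius \<open>r\<close>, where \<open>B\<close> bounds the first derivative of the logarithm
    and \<open>K\<close> is the constant of its Taylor remainder.\<close>
  define r where "r = (1 + norm (a t)) / 2"
  have r: "norm (a t) < r" "r < 1"
    using norm_a[OF t] by (auto simp: r_def)
  define B where "B = 1 / (1 - r)"
  define K where "K = 1 / (1 - r) ^ 2"
  have BK: "0 \<le> B" "0 \<le> K" using r by (auto simp: B_def K_def)
  define E where "E s = norm (a s - a t - (s - t) *\<^sub>R a') / norm (s - t)" for s
  define h where "h s \<xi> = disc_lift q (a s) \<xi> - disc_lift q (a t) \<xi>" for s \<xi>
  have h: "h s \<xi> = 2 * Im (J \<xi> 0 (a s) - J \<xi> 0 (a t))" for s \<xi>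
    by (simp add: h_def disc_lift_def J_def del: ln_jet.simps)
  have lim_E: "(E \<longlongrightarrow> 0) (at t within T)"
    using deriv[OF t] unfolding has_vector_derivative_def has_derivative_iff_norm E_def a'_def by simp
  have lim_a: "(a \<longlongrightarrow> a t) (at t within T)"
    using has_vector_derivative_continuous[OF deriv[OF t]] by (simp add: continuous_within)
  have "((\<lambda>s. 2 * (B * E s + K * ((norm a' + E s) * norm (a s - a t)))) \<longlongrightarrow>
      2 * (B * 0 + K * ((norm a' + 0) * norm (a t - a t)))) (at t within T)"
    by (intro tendsto_intros lim_E lim_a)
  then have lim: "((\<lambda>s. 2 * (B * E s + K * ((norm a' + E s) * norm (a s - a t)))) \<longlongrightarrow> 0) (at t within T)"
    by simp
  have near: "\<forall>\<^sub>F s in at t within T. norm (a s) < r"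
    by (rule order_tendstoD(2)[OF tendsto_norm[OF lim_a] r(1)])
  have ne: "\<forall>\<^sub>F s in at t within T. s \<noteq> t"
    by (simp add: eventually_at_filter)
  have bound: "\<bar>h s \<xi> / (s - t) - 2 * Im (J \<xi> 1 (a t) * a')\<bar>
      \<le> 2 * (B * E s + K * ((norm a' + E s) * norm (a s - a t)))"
    if "norm (a s) < r" "s \<noteq> t" for s \<xi>
  proof -
    define \<Delta> where "\<Delta> = a s - a t"
    define R where "R = J \<xi> 0 (a s) - J \<xi> 0 (a t) - J \<xi> 1 (a t) * \<Delta>"
    have R: "norm R \<le> K * norm \<Delta> ^ 2"
      using ln_jet_Taylor[of "a t" r "a s" "cnj (circle_point q \<xi>)" 0] r that
      by (simp add: R_def J_def K_def \<Delta>_def power2_eq_square del: ln_jet.simps)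
    have J1: "norm (J \<xi> 1 (a t)) \<le> B"
      using norm_ln_jet_le[of "a t" r "cnj (circle_point q \<xi>)" 0] r
      by (simp add: J_def B_def del: ln_jet.simps)
    have \<Delta>: "norm \<Delta> / \<bar>s - t\<bar> \<le> norm a' + E s"
    proof -
      have "norm \<Delta> \<le> norm ((s - t) *\<^sub>R a') + norm (\<Delta> - (s - t) *\<^sub>R a')"
        by (metis add.commute norm_triangle_sub)
      then have "norm \<Delta> / \<bar>s - t\<bar> \<le> (\<bar>s - t\<bar> * norm a' + norm (\<Delta> - (s - t) *\<^sub>R a')) / \<bar>s - t\<bar>"
        by (intro divide_right_mono) auto
      then show ?thesis
        using that by (simp add: E_def \<Delta>_def add_divide_distrib)
    qed
    \<comment> \<open>Two errors remain: that of linearizing the curve \<open>a\<close>, passed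
      through the derivative of the logarithm, and the Taylor remainder \<open>R\<close>. Both are
      controlled independently of \<xi>.\<close>
    have "h s \<xi> / (s - t) - 2 * Im (J \<xi> 1 (a t) * a') =
        2 * Im (J \<xi> 1 (a t) * (\<Delta> - (s - t) *\<^sub>R a') + R) / (s - t)"
    proof -
      have "J \<xi> 0 (a s) - J \<xi> 0 (a t) =
          J \<xi> 1 (a t) * (\<Delta> - (s - t) *\<^sub>R a') + R + (s - t) *\<^sub>R (J \<xi> 1 (a t) * a')"
        by (simp add: R_def algebra_simps)
      then have "h s \<xi> = 2 * Im (J \<xi> 1 (a t) * (\<Delta> - (s - t) *\<^sub>R a') + R)
          + (s - t) * (2 * Im (J \<xi> 1 (a t) * a'))"
        by (simp only: h plus_complex.sel complex_scaleR) (simp add: algebra_simps)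
      then show ?thesis using that by (simp add: add_divide_distrib)
    qed
    then have "\<bar>h s \<xi> / (s - t) - 2 * Im (J \<xi> 1 (a t) * a')\<bar> =
        2 * \<bar>Im (J \<xi> 1 (a t) * (\<Delta> - (s - t) *\<^sub>R a') + R)\<bar> / \<bar>s - t\<bar>"
      by (simp only: abs_mult abs_divide abs_numeral)
    also have "\<dots> \<le> 2 * (B * norm (\<Delta> - (s - t) *\<^sub>R a') + K * norm \<Delta> ^ 2) / \<bar>s - t\<bar>"
      using J1 R
      by (intro divide_right_mono mult_left_mono order.trans[OF abs_Im_le_cmod]
          order.trans[OF norm_triangle_ineq] add_mono) (auto simp: norm_mult intro: mult_right_mono)
    also have "\<dots> = 2 * (B * E s + K * (norm \<Delta> / \<bar>s - t\<bar> * norm \<Delta>))"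
      by (simp add: E_def \<Delta>_def add_divide_distrib power2_eq_square)
    also have "\<dots> \<le> 2 * (B * E s + K * ((norm a' + E s) * norm \<Delta>))"
      using \<Delta> BK by (intro mult_left_mono add_left_mono mult_right_mono) auto
    finally show ?thesis by (simp add: \<Delta>_def)
  qed
  have "uniform_limit {0..1} (\<lambda>s \<xi>. h s \<xi> / (s - t)) (\<lambda>\<xi>. 2 * Im (J \<xi> 1 (a t) * a')) (at t within T)"
  proof (rule uniform_limitI)
    fix e :: real assume "0 < e"
    from near ne order_tendstoD(2)[OF lim this]
    show "\<forall>\<^sub>F s in at t within T. \<forall>\<xi>\<in>{0..1}. dist (h s \<xi> / (s - t)) (2 * Im (J \<xi> 1 (a t) * a')) < e"
      by eventually_elim (auto simp only: dist_real_def intro: order.strict_trans1[OF bound])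
  qed
  then have "uniform_limit {0..1} (\<lambda>s \<xi>. h s \<xi> / (s - t)) (kuramoto_rhs (disc_state q (a t))) (at t within T)"
    by (rule uniform_limit_cong'[THEN iffD1, rotated 2])
      (auto simp: kuramoto_rhs_disc_state norm_a[OF t] J_def a'_def simp del: ln_jet.simps)
  moreover have "disc_state q (a s) \<xi> = disc_state q (a t) \<xi> + to_angle (h s \<xi>)" if "\<xi> \<in> {0..1}" for s \<xi>
    using that by (simp add: disc_state_apply h_def flip: to_angle_add)
  ultimately show "has_state_derivative (\<lambda>t. disc_state q (a t)) (kuramoto_rhs (disc_state q (a t))) (at t within T) t"
    unfolding has_state_derivative_def by (intro exI[of _ h] conjI always_eventually allI ballI)
qed

section \<open>The smooth surface of Moebius states\<close>

definition complex_of_pair :: "real \<times> real \<Rightarrow> complex" where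
  "complex_of_pair p = Complex (fst p) (snd p)"

lemma complex_of_pair_simps [simp]:
  "Re (complex_of_pair p) = fst p" "Im (complex_of_pair p) = snd p"
  "complex_of_pair (Re z, Im z) = z"
  by (simp_all add: complex_of_pair_def)

lemma complex_of_pair_diff: "complex_of_pair (p - p') = complex_of_pair p - complex_of_pair p'"
  by (simp add: complex_eq_iff)

lemma norm_complex_of_pair [simp]: "norm (complex_of_pair p) = norm p"
  by (simp add: cmod_def norm_prod_def)

text \<open>The partial derivative of order \<open>(i, j)\<close> of the angle chart centred at \<open>a\<close>. Each derivative of
  a holomorphic function in the imaginary direction contributes a factor \<open>\<i>\<close>.\<close>

definition disc_chart_jet :: "real \<Rightarrow> complex \<Rightarrow> nat \<Rightarrow> nat \<Rightarrow> real \<times> real \<Rightarrow> real \<Rightarrow> real" where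
  "disc_chart_jet q a i j p \<xi> =
     2 * Im (\<i> ^ j * ln_jet (cnj (circle_point q \<xi>)) (i + j) (complex_of_pair p)) -
     (if i = 0 \<and> j = 0 then 2 * Im (ln_jet (cnj (circle_point q \<xi>)) 0 a) else 0)"

lemma continuous_on_disc_chart_jet:
  assumes "norm a < 1" "norm p < 1"
  shows "continuous_on A (disc_chart_jet q a i j p)"
  unfolding disc_chart_jet_def using assms
  by (cases "i = 0 \<and> j = 0") (auto intro!: continuous_intros continuous_on_ln_jet simp del: ln_jet.simps)

lemma has_Linf_partials_disc_chart_jet:
  assumes "norm p < 1"
  shows "has_Linf_partials p (disc_chart_jet q a i j)
    (disc_chart_jet q a (Suc i) j p) (disc_chart_jet q a i (Suc j) p)"
  unfolding has_Linf_partials_def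
proof (rule uniform_limitI)
  fix e :: real assume e: "0 < e"
  define r where "r = (1 + norm p) / 2"
  have r: "norm p < r" "r < 1" using assms by (auto simp: r_def)
  define K where "K = 2 * (fact (Suc (i + j)) / (1 - r) ^ Suc (Suc (i + j)))"
  let ?N = "\<lambda>p' \<xi>. disc_chart_jet q a i j p' \<xi> - disc_chart_jet q a i j p \<xi> -
    (fst (p' - p) * disc_chart_jet q a (Suc i) j p \<xi> + snd (p' - p) * disc_chart_jet q a i (Suc j) p \<xi>)"
  have bound: "\<bar>?N p' \<xi>\<bar> \<le> K * norm (p' - p) ^ 2" if "norm p' < r" for p' \<xi>
  proof -
    define J where "J = ln_jet (cnj (circle_point q \<xi>))"
    define \<Delta> where "\<Delta> = complex_of_pair (p' - p)"
    have \<Delta>: "\<Delta> = of_real (fst (p' - p)) + \<i> * of_real (snd (p' - p))"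
      by (simp add: \<Delta>_def complex_eq_iff)
    \<comment> \<open>A real step in the plane is the complex step \<Delta>. The factor \<i> in the
      second partial derivative lets both linear terms combine into the complex derivative applied
      to \<Delta>, so the holomorphic Taylor estimate applies.\<close>
    have "?N p' \<xi> = 2 * Im (\<i> ^ j * (J (i + j) (complex_of_pair p') - J (i + j) (complex_of_pair p)
        - J (Suc (i + j)) (complex_of_pair p) * \<Delta>))"
      by (simp add: disc_chart_jet_def J_def[symmetric] \<Delta> algebra_simps del: ln_jet.simps)
    also have "\<bar>\<dots>\<bar> \<le> 2 * norm (J (i + j) (complex_of_pair p') - J (i + j) (complex_of_pair p)
        - J (Suc (i + j)) (complex_of_pair p) * \<Delta>)"
    proof -
      have "\<bar>2 * Im (\<i> ^ j * z)\<bar> \<le> 2 * norm z" for z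
        using abs_Im_le_cmod[of "\<i> ^ j * z"] by (simp add: norm_mult norm_power)
      then show ?thesis .
    qed
    also have "\<dots> \<le> K * norm (p' - p) ^ 2"
      using ln_jet_Taylor[of "complex_of_pair p" r "complex_of_pair p'" "cnj (circle_point q \<xi>)" "i + j"] r that
      by (simp add: K_def J_def \<Delta>_def complex_of_pair_diff[symmetric] del: ln_jet.simps)
    finally show ?thesis .
  qed
  have "((\<lambda>p'. K * norm (p' - p)) \<longlongrightarrow> K * norm (p - p)) (at p)"
    by (intro tendsto_intros)
  then have lim: "((\<lambda>p'. K * norm (p' - p)) \<longlongrightarrow> 0) (at p)"
    by simp
  have near: "\<forall>\<^sub>F p' in at p. norm p' < r"
    by (rule order_tendstoD(2)[OF tendsto_norm[OF tendsto_ident_at] r(1)])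
  have ne: "\<forall>\<^sub>F p' in at p. p' \<noteq> p"
    by (simp add: eventually_at_filter)
  from near ne order_tendstoD(2)[OF lim e]
  show "\<forall>\<^sub>F p' in at p. \<forall>\<xi>\<in>{0..1}. dist (?N p' \<xi> / norm (p' - p)) 0 < e"
  proof eventually_elim
    case (elim p')
    show ?case
    proof
      fix \<xi> :: real
      have "\<bar>?N p' \<xi>\<bar> / norm (p' - p) \<le> K * norm (p' - p) ^ 2 / norm (p' - p)"
        by (intro divide_right_mono bound elim norm_ge_zero)
      also have "\<dots> = K * norm (p' - p)"
        using elim by (simp add: power2_eq_square)
      finally show "dist (?N p' \<xi> / norm (p' - p)) 0 < e"
        using elim(3) by (simp only: dist_real_def diff_0_right abs_divide abs_norm_cancel)
    qed
  qed
qed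

text \<open>The combination is \<open>2 * Im (s * c / (1 + b * c))\<close> with
  \<open>s = u + \<i> v\<close>, and \<open>c\<close> ranges over the whole unit circle. Multiplying
  by \<open>|1 + b c|^2\<close> clears the denominator and leaves a constant plus a first
  harmonic.\<close>

lemma disc_chart_immersion:
  assumes p: "norm p < 1"
    and zero: "\<And>\<xi>. \<xi> \<in> {0..1} \<Longrightarrow>
      u * disc_chart_jet q a 1 0 p \<xi> + v * disc_chart_jet q a 0 1 p \<xi> = 0"
  shows "u = 0 \<and> v = 0"
proof -
  define s where "s = Complex u v"
  define b where "b = complex_of_pair p"
  have eq: "Im (s * c) + Im (s * cnj b) = 0" if c: "norm c = 1" for c
  proof -
    obtain \<xi> where \<xi>: "\<xi> \<in> {0..1}" "circle_point q \<xi> = cnj c"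
      using circle_point_surj[of "cnj c" q] c by auto
    have nz: "1 + b * c \<noteq> 0"
      using disc_denominator_nonzero[of b c] p c by (simp add: b_def)
    define w where "w = c / (1 + b * c)"
    have "disc_chart_jet q a 1 0 p \<xi> = 2 * Im w" "disc_chart_jet q a 0 1 p \<xi> = 2 * Im (\<i> * w)"
      by (simp_all add: disc_chart_jet_def \<xi> b_def w_def)
    then have "u * disc_chart_jet q a 1 0 p \<xi> + v * disc_chart_jet q a 0 1 p \<xi> = 2 * Im (s * w)"
      by (simp add: s_def algebra_simps)
    then have "Im (s * c / (1 + b * c)) = 0"
      using zero[OF \<xi>(1)] by (simp add: w_def)
    then have "Im (s * c * cnj (1 + b * c)) = 0"
      using nz by (metis complex_cnj_mult complex_div_cnj complex_mult_cnj Im_divide_of_real divide_eq_0_iff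
          norm_eq_zero of_real_power complex_norm_square power_eq_0_iff)
    moreover have "s * c * cnj (1 + b * c) = s * c + s * cnj b * (c * cnj c)"
      by (simp add: algebra_simps)
    moreover have "c * cnj c = 1"
      using c by (simp flip: complex_norm_square)
    ultimately show ?thesis
      by (metis mult.right_neutral plus_complex.sel(2))
  qed
  \<comment> \<open>The points 1 and -1 give \<open>Im s = 0\<close> and
    \<open>Im (s * cnj b) = 0\<close>; then \<i> gives \<open>Re s = 0\<close>.\<close>
  from eq[of 1] eq[of "- 1"] eq[of \<i>] show ?thesis
    by (simp add: s_def)
qed

lemma smooth_immersion_disc_chart:
  assumes "norm a < 1"
  shows "smooth_immersion_Linf (ball 0 1) (disc_chart_jet q a 0 0)"
  unfolding smooth_immersion_Linf_def
proof (intro exI[of _ "disc_chart_jet q a"] conjI refl allI ballI impI)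
  fix i j and p :: "real \<times> real" assume "p \<in> ball 0 1"
  then have p: "norm p < 1" by simp
  have cont: "continuous_on {0..1} (disc_chart_jet q a i j p)"
    by (rule continuous_on_disc_chart_jet[OF assms p])
  show "disc_chart_jet q a i j p \<in> borel_measurable (lebesgue_on {0..1})"
    by (rule continuous_imp_measurable_on_sets_lebesgue[OF cont]) auto
  show "bounded (disc_chart_jet q a i j p ` {0..1})"
    by (intro compact_imp_bounded compact_continuous_image cont) auto
  show "has_Linf_partials p (disc_chart_jet q a i j) (disc_chart_jet q a (Suc i) j p) (disc_chart_jet q a i (Suc j) p)"
    by (rule has_Linf_partials_disc_chart_jet[OF p])
next
  fix p :: "real \<times> real" and u v assume "p \<in> ball 0 1"
    "\<forall>\<xi>\<in>{0..1}. u * disc_chart_jet q a 1 0 p \<xi> + v * disc_chart_jet q a 0 1 p \<xi> = 0"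
  then have "u = 0 \<and> v = 0"
    by (intro disc_chart_immersion[of p u q a v]) auto
  then show "u = 0" "v = 0" by auto
qed

lemma continuous_map_order_parameter:
  "continuous_map (mtopology_of state_space) euclidean order_parameter"
proof -
  have "Lipschitz_continuous_map state_space euclidean_metric order_parameter"
    unfolding Lipschitz_continuous_map_def
    by (intro conjI exI[of _ 1]) (auto simp: dist_norm order_parameter_dist_le)
  then show ?thesis
    using Lipschitz_continuous_imp_continuous_map by fastforce
qed

lemma continuous_map_disc_state:
  "continuous_map (top_of_set (ball 0 1)) (mtopology_of state_space) (disc_state q)"
  unfolding mtopology_of_def Metric_space.continuous_map_to_metric[OF Metric_space_mspace_mdist]
proof (intro ballI allI impI)
  fix a :: complex and e :: real
  assume "a \<in> topspace (top_of_set (ball 0 1))" and e: "0 < e"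
  then have a: "norm a < 1" by simp
  define r where "r = (1 + norm a) / 2"
  have r: "norm a < r" "r < 1" using a by (auto simp: r_def)
  define \<delta> where "\<delta> = e * (1 - r) / 2"
  have \<delta>: "0 < \<delta>" using e r by (simp add: \<delta>_def)
  have "openin (top_of_set (ball 0 1)) (ball 0 r \<inter> ball a \<delta>)"
    using r by (auto simp: openin_open_eq)
  moreover have "a \<in> ball 0 r \<inter> ball a \<delta>"
    using r \<delta> by simp
  moreover have "disc_state q b \<in> Metric_space.mball (mspace state_space) (mdist state_space) (disc_state q a) e"
    if "b \<in> ball 0 r \<inter> ball a \<delta>" for b
  proof -
    have "mdist state_space (disc_state q a) (disc_state q b) \<le> 2 / (1 - r) * norm (a - b)"
      using that r by (intro mdist_disc_state_le) auto
    also have "\<dots> < 2 / (1 - r) * \<delta>"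
      using that r by (intro mult_strict_left_mono) (auto simp: dist_norm)
    also have "\<dots> = e"
      using r by (simp add: \<delta>_def)
    finally show ?thesis
      using that r by (simp add: Metric_space.in_mball[OF Metric_space_mspace_mdist] disc_state_mem)
  qed
  ultimately show "\<exists>U. openin (top_of_set (ball 0 1)) U \<and> a \<in> U \<and>
      (\<forall>b\<in>U. disc_state q b \<in> Metric_space.mball (mspace state_space) (mdist state_space) (disc_state q a) e)"
    by blast
qed

definition disc_states :: "real \<Rightarrow> (real \<Rightarrow> angle) set" where
  "disc_states q = disc_state q ` ball 0 1"

lemma homeomorphic_map_disc_state:
  "homeomorphic_map (top_of_set (ball 0 1)) (subtopology (mtopology_of state_space) (disc_states q))
    (\<lambda>p. disc_state q (complex_of_pair p))"
proof (rule homeomorphic_maps_imp_map)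
  let ?g = "\<lambda>x. (Re (order_parameter x), Im (order_parameter x))"
  have "continuous_map (top_of_set (ball 0 1)) (top_of_set (ball 0 1)) complex_of_pair"
    by (auto intro!: continuous_intros simp: complex_of_pair_def[abs_def])
      (metis fst_conv snd_conv norm_complex_of_pair complex_of_pair_def)
  from continuous_map_compose[OF this continuous_map_disc_state[of q]]
  have f: "continuous_map (top_of_set (ball 0 1)) (subtopology (mtopology_of state_space) (disc_states q))
      (\<lambda>p. disc_state q (complex_of_pair p))"
    by (auto simp: continuous_map_in_subtopology o_def disc_states_def)
  have "continuous_map euclidean euclidean (\<lambda>z. (Re z, Im z))"
    by (auto intro!: continuous_intros)
  from continuous_map_compose[OF continuous_map_order_parameter this]
  have "continuous_map (subtopology (mtopology_of state_space) (disc_states q)) euclidean ?g"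
    by (intro continuous_map_from_subtopology) (simp add: o_def)
  moreover have "norm (?g x) < 1" if "x \<in> disc_states q" for x
  proof -
    obtain a where "norm a < 1" "x = disc_state q a"
      using \<open>x \<in> disc_states q\<close> by (auto simp: disc_states_def)
    then show ?thesis
      by (simp add: order_parameter_disc_state norm_prod_def cmod_def)
  qed
  ultimately have g: "continuous_map (subtopology (mtopology_of state_space) (disc_states q))
      (top_of_set (ball 0 1)) ?g"
    by (auto simp: continuous_map_in_subtopology)
  show "homeomorphic_maps (top_of_set (ball 0 1)) (subtopology (mtopology_of state_space) (disc_states q))
      (\<lambda>p. disc_state q (complex_of_pair p)) ?g"
    unfolding homeomorphic_maps_def
    by (intro conjI f g) (auto simp: order_parameter_disc_state disc_states_def)
qed

lemma embedded_smooth_surface_disc_states: "embedded_smooth_surface (disc_states q)"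
  unfolding embedded_smooth_surface_def
proof (intro conjI ballI)
  show W: "disc_states q \<subseteq> mspace state_space"
    by (auto simp: disc_states_def disc_state_mem)
  fix x assume "x \<in> disc_states q"
  then obtain a where a: "norm a < 1" and x: "x = disc_state q a"
    by (auto simp: disc_states_def)
  \<comment> \<open>The constant subtracted in the chart cancels against the lift of
    \<open>x\<close>. Every centre therefore yields the same parametrization, and one homeomorphism
    serves all points with the whole space as neighbourhood.\<close>
  have "(\<lambda>p. \<lambda>\<xi>\<in>{0..1}. x \<xi> + to_angle (disc_chart_jet q a 0 0 p \<xi>))
      = (\<lambda>p. disc_state q (complex_of_pair p))"
    by (intro ext)
      (auto simp: x disc_state_def disc_chart_jet_def disc_lift_def restrict_def to_angle_add[symmetric] add.assoc
        simp del: ln_jet.simps)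
  then have "homeomorphic_map (top_of_set (ball 0 1))
      (subtopology (mtopology_of state_space) (disc_states q \<inter> mspace state_space))
      (\<lambda>p. \<lambda>\<xi>\<in>{0..1}. x \<xi> + to_angle (disc_chart_jet q a 0 0 p \<xi>))"
    using homeomorphic_map_disc_state[of q] W by (simp add: Int_absorb2)
  moreover have "openin (mtopology_of state_space) (mspace state_space)"
    using openin_topspace[of "mtopology_of state_space"] by simp
  ultimately show "\<exists>U D \<Phi>. openin (mtopology_of state_space) U \<and> x \<in> U \<and> open D \<and>
      smooth_immersion_Linf D \<Phi> \<and>
      homeomorphic_map (top_of_set D) (subtopology (mtopology_of state_space) (disc_states q \<inter> U))
        (\<lambda>p. \<lambda>\<xi>\<in>{0..1}. x \<xi> + to_angle (\<Phi> p \<xi>))"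
    using smooth_immersion_disc_chart[OF a, of q] disc_state_mem[OF a, of q] x open_ball
    by blast
qed

section \<open>Radial solutions and their limit in the past\<close>

text \<open>The squared modulus of \<open>a\<close> obeys the logistic equation, with solution
  \<open>m e^t / (1 - m + m e^t)\<close> from the initial value m. This is the square root with the
  factor \<open>sqrt m\<close> removed: it multiplies the initial \<open>a\<close>, including
  \<open>a = 0\<close>.\<close>

definition radial_flow :: "real \<Rightarrow> real \<Rightarrow> real" where
  "radial_flow m t = exp (t / 2) / sqrt (1 - m + m * exp t)"

lemma radial_flow_denominator_pos: "0 \<le> m \<Longrightarrow> m < 1 \<Longrightarrow> 0 < 1 - m + m * exp (t::real)"
  by (smt (verit) exp_gt_zero mult_nonneg_nonneg)

lemma radial_flow_square:
  assumes "0 \<le> m" "m < 1"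
  shows "1 - m * (radial_flow m t)\<^sup>2 = (1 - m) / (1 - m + m * exp t)"
proof -
  have "(exp (t / 2))\<^sup>2 = exp t"
    by (simp add: power2_eq_square flip: exp_add)
  then show ?thesis
    using radial_flow_denominator_pos[OF assms, of t]
    by (simp add: radial_flow_def power_divide field_simps)
qed

lemma radial_flow_deriv:
  assumes "0 \<le> m" "m < 1"
  shows "(radial_flow m has_real_derivative radial_flow m t * (1 - m * (radial_flow m t)\<^sup>2) / 2) (at t within A)"
proof -
  define d where "d = 1 - m + m * exp t"
  have d: "0 < d" unfolding d_def by (rule radial_flow_denominator_pos[OF assms])
  have "((\<lambda>t. exp (t / 2) / sqrt (1 - m + m * exp t)) has_real_derivative
      (exp (t / 2) / 2 * sqrt d - exp (t / 2) * (m * exp t / (2 * sqrt d))) / (sqrt d * sqrt d)) (at t within A)"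
    using d by (auto intro!: derivative_eq_intros simp: d_def[symmetric] divide_simps)
  moreover have "(exp (t / 2) / 2 * sqrt d - exp (t / 2) * (m * exp t / (2 * sqrt d))) / (sqrt d * sqrt d)
      = exp (t / 2) / sqrt d * ((1 - m) / d) / 2"
  proof -
    have "(x / 2 * s - x * (k / (2 * s))) / (s * s) = x / s * ((s * s - k) / (s * s)) / 2"
      if "s \<noteq> 0" for x k s :: real
      using that by (simp add: field_simps)
    from this[of "sqrt d" "exp (t / 2)" "m * exp t"] show ?thesis
      using d by (simp add: d_def)
  qed
  ultimately show ?thesis
    using radial_flow_square[OF assms, of t] by (simp add: radial_flow_def[abs_def] d_def)
qed

lemma radial_flow_lim:
  assumes "0 \<le> m" "m < 1"
  shows "(radial_flow m \<longlongrightarrow> 0) at_bot"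
proof -
  have "((\<lambda>t::real. exp (t / 2)) \<longlongrightarrow> 0) at_bot"
    using filterlim_compose[OF exp_at_bot
        filterlim_tendsto_pos_mult_at_bot[OF tendsto_const[of "1 / 2 :: real"] _ filterlim_ident]]
    by simp
  then have "((\<lambda>t::real. exp (t / 2) / sqrt (1 - m + m * exp t)) \<longlongrightarrow> 0 / sqrt (1 - m + m * 0)) at_bot"
    using assms by (intro tendsto_intros exp_at_bot) auto
  then show ?thesis by (simp add: radial_flow_def[abs_def])
qed

lemma disc_state_in_unstable_manifold:
  assumes a: "norm a < 1"
  shows "disc_state q a \<in> unstable_manifold (twisted_state q)"
proof -
  define m where "m = (norm a)\<^sup>2"
  have m: "0 \<le> m" "m < 1"
    using a by (auto simp: m_def power_less_one_iff)
  define A where "A t = a * of_real (radial_flow m t)" for t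
  have norm_A: "(norm (A t))\<^sup>2 = m * (radial_flow m t)\<^sup>2" for t
    by (simp add: A_def m_def norm_mult power_mult_distrib)
  have A1: "norm (A t) < 1" for t
  proof -
    have "0 < (1 - m) / (1 - m + m * exp t)"
      using m radial_flow_denominator_pos[OF m] by simp
    then have "(norm (A t))\<^sup>2 < 1"
      using radial_flow_square[OF m, of t] norm_A[of t] by simp
    then show ?thesis by (simp add: power_less_one_iff abs_square_less_1)
  qed
  have "(A has_vector_derivative A t * of_real (1 - (norm (A t))\<^sup>2) / 2) (at t within {..0})" for t
  proof -
    have "((\<lambda>t. a * of_real (radial_flow m t)) has_vector_derivative
        a * of_real (radial_flow m t * (1 - m * (radial_flow m t)\<^sup>2) / 2)) (at t within {..0})"
      by (intro has_vector_derivative_mult_right has_vector_derivative_of_real radial_flow_deriv m)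
    then show ?thesis
      by (simp add: A_def[abs_def] norm_A[unfolded A_def] mult.assoc)
  qed
  then have "kuramoto_solution {..0} (\<lambda>t. disc_state q (A t))"
    using A1 by (intro kuramoto_solution_disc_state) auto
  moreover have "disc_state q (A 0) = disc_state q a"
    by (simp add: A_def radial_flow_def)
  moreover have "limitin (mtopology_of state_space) (\<lambda>t. disc_state q (A t)) (twisted_state q) at_bot"
    unfolding disc_state_0[symmetric]
  proof (subst limitin_state_space_iff, goal_cases)
    case 1
    show ?case by (rule disc_state_mem) simp
  next
    case 2
    show ?case
    proof (intro allI impI)
      fix e :: real assume "0 < e"
      have "((\<lambda>t. norm (a * of_real (radial_flow m t))) \<longlongrightarrow> norm (a * of_real 0)) at_bot"
        by (intro tendsto_intros radial_flow_lim m)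
      then have lim: "((\<lambda>t. norm (A t)) \<longlongrightarrow> 0) at_bot"
        by (simp add: A_def)
      \<comment> \<open>In the ball of radius 1/2 the Lipschitz constant \<open>2 / (1 - r)\<close>
        of \<open>disc_state\<close> is 4.\<close>
      from order_tendstoD(2)[OF lim, of "min (1/2) (e / 4)"] \<open>0 < e\<close>
      have "\<forall>\<^sub>F t in at_bot. norm (A t) < min (1/2) (e / 4)" by simp
      then show "\<forall>\<^sub>F t in at_bot. disc_state q (A t) \<in> mspace state_space \<and>
          mdist state_space (disc_state q (A t)) (disc_state q 0) < e"
      proof eventually_elim
        case (elim t)
        then show ?case
          using mdist_disc_state_le[of "A t" "1/2" 0 q] by (simp add: disc_state_mem)
      qed
    qed
  qed
  ultimately show ?thesis
    unfolding unstable_manifold_def by blast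
qed

section \<open>The Ott-Antonsen parametrization\<close>

text \<open>On a period this is 2 pi times the distribution function without the constant that makes
  the latter vanish at 0. That constant is exactly what \<open>oa_shift\<close> compensates.\<close>

definition oa_phase :: "real \<Rightarrow> real \<Rightarrow> real \<Rightarrow> real" where
  "oa_phase \<alpha> \<beta> \<theta> = \<theta> + 2 * arctan (\<beta> * sin (\<theta> + \<alpha>) / (1 - \<beta> * cos (\<theta> + \<alpha>)))"

definition oa_coordinate :: "real \<Rightarrow> real \<Rightarrow> complex" where
  "oa_coordinate \<alpha> \<beta> = of_real \<beta> * cis (- \<alpha>)"

lemma norm_oa_coordinate: "0 \<le> \<beta> \<Longrightarrow> norm (oa_coordinate \<alpha> \<beta>) = \<beta>"
  by (simp add: oa_coordinate_def norm_mult)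

lemma mult_cos_less_1:
  assumes "0 \<le> \<beta>" "\<beta> < 1"
  shows "\<beta> * cos x < (1::real)"
  using mult_left_mono[OF cos_le_one[of x] assms(1)] assms(2) by simp

lemma poisson_denominator_pos:
  assumes "0 \<le> \<beta>" "\<beta> < (1::real)"
  shows "0 < 1 - 2 * \<beta> * cos x + \<beta>\<^sup>2"
proof -
  have "(1 - \<beta>)\<^sup>2 \<le> 1 - 2 * \<beta> * cos x + \<beta>\<^sup>2"
    using mult_left_mono[OF cos_le_one[of x] assms(1)] by (simp add: power2_eq_square algebra_simps)
  then show ?thesis
    using assms by (smt (verit) zero_less_power)
qed

lemma oa_density_pos:
  assumes "0 \<le> \<beta>" "\<beta> < 1"
  shows "0 < oa_density \<alpha> \<beta> \<theta>"
  using assms poisson_denominator_pos[OF assms, of "\<alpha> + \<theta>"]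
  by (auto simp: oa_density_def abs_square_less_1 intro!: divide_pos_pos mult_pos_pos)

lemma oa_phase_deriv:
  assumes "0 \<le> \<beta>" "\<beta> < 1"
  shows "(oa_phase \<alpha> \<beta> has_real_derivative 2 * pi * oa_density \<alpha> \<beta> \<theta>) (at \<theta> within A)"
proof -
  define s c where "s = sin (\<theta> + \<alpha>)" and "c = cos (\<theta> + \<alpha>)"
  have x: "0 < 1 - \<beta> * c"
    using mult_cos_less_1[OF assms] by (simp add: c_def)
  have sc: "s\<^sup>2 = 1 - c\<^sup>2"
    by (simp add: s_def c_def sin_squared_eq)
  \<comment> \<open>The derivative of the arctangent of a quotient has the sum of the squares of its
    two terms as denominator. Here this is the squared modulus of
    \<open>1 - \<beta> cis (\<theta> + \<alpha>)\<close>, the Poisson denominator.\<close>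
  have \<kappa>: "(1 - \<beta> * c)\<^sup>2 + (\<beta> * s)\<^sup>2 = 1 - 2 * \<beta> * c + \<beta>\<^sup>2"
    unfolding power_mult_distrib sc by (simp add: power2_eq_square algebra_simps)
  have pos: "0 < 1 - 2 * \<beta> * c + \<beta>\<^sup>2"
    unfolding c_def by (rule poisson_denominator_pos[OF assms])
  let ?X = "1 - \<beta> * c"
  have quot: "((\<lambda>\<theta>. \<beta> * sin (\<theta> + \<alpha>) / (1 - \<beta> * cos (\<theta> + \<alpha>))) has_real_derivative
      (\<beta> * c * ?X - \<beta> * s * (\<beta> * s)) / (?X * ?X)) (at \<theta> within A)"
    using x by (auto intro!: derivative_eq_intros simp: s_def[symmetric] c_def[symmetric])
  have "((\<lambda>\<theta>. arctan (\<beta> * sin (\<theta> + \<alpha>) / (1 - \<beta> * cos (\<theta> + \<alpha>)))) has_real_derivative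
      inverse (1 + (\<beta> * s / ?X)\<^sup>2) * ((\<beta> * c * ?X - \<beta> * s * (\<beta> * s)) / (?X * ?X))) (at \<theta> within A)"
    using DERIV_chain2[OF DERIV_arctan quot] by (simp add: s_def c_def)
  then have "(oa_phase \<alpha> \<beta> has_real_derivative
      1 + 2 * (inverse (1 + (\<beta> * s / ?X)\<^sup>2) * ((\<beta> * c * ?X - \<beta> * s * (\<beta> * s)) / (?X * ?X)))) (at \<theta> within A)"
    unfolding oa_phase_def[abs_def] by (intro DERIV_add DERIV_ident DERIV_cmult)
  also have "1 + 2 * (inverse (1 + (\<beta> * s / ?X)\<^sup>2) * ((\<beta> * c * ?X - \<beta> * s * (\<beta> * s)) / (?X * ?X)))
      = 1 + 2 * ((\<beta> * c * ?X - \<beta> * s * (\<beta> * s)) / (?X\<^sup>2 * (1 + (\<beta> * s / ?X)\<^sup>2)))"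
    by (simp add: divide_inverse power2_eq_square)
  also have "?X\<^sup>2 * (1 + (\<beta> * s / ?X)\<^sup>2) = 1 - 2 * \<beta> * c + \<beta>\<^sup>2"
    using x by (simp add: \<kappa>[symmetric] power_divide distrib_left)
  also have "\<beta> * c * ?X - \<beta> * s * (\<beta> * s) = \<beta> * c - \<beta>\<^sup>2 * (c\<^sup>2 + s\<^sup>2)"
    by (simp add: power2_eq_square algebra_simps)
  also have "1 + 2 * ((\<beta> * c - \<beta>\<^sup>2 * (c\<^sup>2 + s\<^sup>2)) / (1 - 2 * \<beta> * c + \<beta>\<^sup>2)) = 2 * pi * oa_density \<alpha> \<beta> \<theta>"
  proof -
    define k where "k = 1 - 2 * \<beta> * c + \<beta>\<^sup>2"
    have "2 * pi * oa_density \<alpha> \<beta> \<theta> = (1 - \<beta>\<^sup>2) / k"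
      by (simp add: oa_density_def k_def c_def add.commute)
    moreover have "1 - \<beta>\<^sup>2 = k + 2 * (\<beta> * c - \<beta>\<^sup>2 * (c\<^sup>2 + s\<^sup>2))"
      by (simp add: k_def sc)
    ultimately show ?thesis
      using pos unfolding k_def[symmetric] by (simp add: add_divide_distrib)
  qed
  finally show ?thesis .
qed

lemma continuous_on_oa_phase:
  assumes "0 \<le> \<beta>" "\<beta> < 1"
  shows "continuous_on A (oa_phase \<alpha> \<beta>)"
  by (rule DERIV_continuous_on[OF oa_phase_deriv[OF assms]])

lemma oa_phase_less:
  assumes "0 \<le> \<beta>" "\<beta> < 1" "\<theta> < \<theta>'"
  shows "oa_phase \<alpha> \<beta> \<theta> < oa_phase \<alpha> \<beta> \<theta>'"
  using assms(3)
proof (rule DERIV_pos_imp_increasing)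
  show "\<exists>y. (oa_phase \<alpha> \<beta> has_real_derivative y) (at x) \<and> 0 < y" for x
    using oa_phase_deriv[OF assms(1,2), of \<alpha> x UNIV] oa_density_pos[OF assms(1,2), of \<alpha> x] by auto
qed

lemma oa_phase_2pi: "oa_phase \<alpha> \<beta> (2 * pi) = oa_phase \<alpha> \<beta> 0 + 2 * pi"
  using sin_periodic[of \<alpha>] cos_periodic[of \<alpha>] by (simp add: oa_phase_def add.commute)

lemma oa_phase_0: "oa_phase \<alpha> \<beta> 0 = - (2 * pi * oa_shift \<alpha> \<beta>)"
  by (simp add: oa_phase_def oa_shift_def)

lemma oa_cdf_eq:
  assumes "0 \<le> \<beta>" "\<beta> < 1" "0 \<le> \<theta>"
  shows "oa_cdf \<alpha> \<beta> \<theta> = (oa_phase \<alpha> \<beta> \<theta> - oa_phase \<alpha> \<beta> 0) / (2 * pi)"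
proof -
  have "((\<lambda>x. 2 * pi * oa_density \<alpha> \<beta> x) has_integral oa_phase \<alpha> \<beta> \<theta> - oa_phase \<alpha> \<beta> 0) {0..\<theta>}"
    using oa_phase_deriv[OF assms(1,2)] assms(3)
    by (intro fundamental_theorem_of_calculus) (auto simp: has_real_derivative_iff_has_vector_derivative[symmetric])
  then have "((\<lambda>x. 2 * pi * oa_density \<alpha> \<beta> x / (2 * pi)) has_integral
      (oa_phase \<alpha> \<beta> \<theta> - oa_phase \<alpha> \<beta> 0) / (2 * pi)) {0..\<theta>}"
    by (rule has_integral_divide)
  then show ?thesis
    by (simp add: oa_cdf_def integral_unique)
qed

lemma oa_cdf_inv_eq:
  assumes "0 \<le> \<beta>" "\<beta> < 1"
  obtains \<theta> where "oa_cdf_inv \<alpha> \<beta> s = to_angle \<theta>"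
    "oa_phase \<alpha> \<beta> \<theta> = oa_phase \<alpha> \<beta> 0 + 2 * pi * frac s"
proof -
  have "oa_phase \<alpha> \<beta> 0 \<le> oa_phase \<alpha> \<beta> 0 + 2 * pi * frac s"
    by (simp add: frac_ge_0)
  moreover have "oa_phase \<alpha> \<beta> 0 + 2 * pi * frac s \<le> oa_phase \<alpha> \<beta> (2 * pi)"
    using frac_lt_1[of s] by (simp add: oa_phase_2pi)
  ultimately have "\<exists>\<theta>\<ge>0. \<theta> \<le> 2 * pi \<and> oa_phase \<alpha> \<beta> \<theta> = oa_phase \<alpha> \<beta> 0 + 2 * pi * frac s"
    by (rule IVT') (simp_all add: continuous_on_oa_phase[OF assms])
  then obtain \<theta> where \<theta>: "0 \<le> \<theta>" "\<theta> \<le> 2 * pi"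
      "oa_phase \<alpha> \<beta> \<theta> = oa_phase \<alpha> \<beta> 0 + 2 * pi * frac s"
    by blast
  \<comment> \<open>Since \<open>frac s\<close> is strictly below 1, the endpoint excluded from the
    half-open fundamental domain is not attained.\<close>
  have "\<theta> \<noteq> 2 * pi"
    using \<theta>(3) frac_lt_1[of s] by (auto simp: oa_phase_2pi)
  then have mem: "\<theta> \<in> {0..<2 * pi}" using \<theta> by simp
  have "inj_on (oa_cdf \<alpha> \<beta>) {0..<2 * pi}"
  proof (rule inj_onI)
    fix x y assume "x \<in> {0..<2 * pi}" "y \<in> {0..<2 * pi}" "oa_cdf \<alpha> \<beta> x = oa_cdf \<alpha> \<beta> y"
    then have "oa_phase \<alpha> \<beta> x = oa_phase \<alpha> \<beta> y"
      using assms by (simp add: oa_cdf_eq)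
    then show "x = y"
      using oa_phase_less[OF assms, of x y \<alpha>] oa_phase_less[OF assms, of y x \<alpha>] by force
  qed
  moreover have "oa_cdf \<alpha> \<beta> \<theta> = frac s"
    using \<theta> assms by (simp add: oa_cdf_eq)
  ultimately have "the_inv_into {0..<2 * pi} (oa_cdf \<alpha> \<beta>) (frac s) = \<theta>"
    using the_inv_into_f_eq mem by metis
  then show ?thesis
    using that \<theta>(3) by (simp add: oa_cdf_inv_def)
qed

text \<open>For positive real part, \<open>arctan (y / x)\<close> is the argument of the point with
  coordinates x and y; after doubling, the modulus cancels in the quotient by the conjugate.\<close>

lemma cis_2_arctan_divide:
  assumes "0 < x"
  shows "cis (2 * arctan (y / x)) = Complex x y / Complex x (- y)"
proof -
  define t where "t = y / x"
  have pos: "0 < 1 + t\<^sup>2" by (simp add: add_pos_nonneg)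
  have c: "cis (arctan t) = (1 + \<i> * of_real t) / of_real (sqrt (1 + t\<^sup>2))"
    by (simp add: complex_eq_iff cos_arctan sin_arctan)
  have "cis (2 * arctan t) = cis (arctan t) * cis (arctan t)"
    by (simp add: cis_mult)
  also have "\<dots> = (1 + \<i> * of_real t) * (1 + \<i> * of_real t) / of_real (1 + t\<^sup>2)"
    unfolding c using pos by (simp flip: of_real_mult)
  also have "\<dots> = (1 + \<i> * of_real t) / (1 - \<i> * of_real t)"
  proof -
    have "complex_of_real (1 + t\<^sup>2) = (1 + \<i> * of_real t) * (1 - \<i> * of_real t)"
      by (simp add: algebra_simps power2_eq_square)
    moreover have "1 + \<i> * of_real t \<noteq> 0"
      by (simp add: complex_eq_iff)
    ultimately show ?thesis by simp
  qed
  also have "\<dots> = (of_real x * (1 + \<i> * of_real t)) / (of_real x * (1 - \<i> * of_real t))"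
    using assms by simp
  also have "of_real x * (1 + \<i> * of_real t) = Complex x y"
    using assms by (simp add: complex_eq_iff t_def)
  also have "of_real x * (1 - \<i> * of_real t) = Complex x (- y)"
    using assms by (simp add: complex_eq_iff t_def)
  finally show ?thesis by (simp add: t_def)
qed

text \<open>The arctangent in the phase is the argument of \<open>1 - a * cis (- \<theta>)\<close>.
  The phase thus realizes the inverse of the Moebius map in \<open>cis_disc_state\<close>, and
  inverting the distribution function means applying that map.\<close>

lemma cis_oa_phase:
  fixes \<alpha> \<beta> \<theta> :: real
  assumes "0 \<le> \<beta>" "\<beta> < 1"
  defines "a \<equiv> oa_coordinate \<alpha> \<beta>"
  shows "cis (oa_phase \<alpha> \<beta> \<theta>) = (cis \<theta> - a) / (1 - cnj a * cis \<theta>)"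
proof -
  have a: "a * cis (- \<theta>) = cnj (of_real \<beta> * cis (\<theta> + \<alpha>))" "cnj a * cis \<theta> = of_real \<beta> * cis (\<theta> + \<alpha>)"
    by (simp_all add: a_def oa_coordinate_def cis_mult cis_cnj algebra_simps)
  have "cis (oa_phase \<alpha> \<beta> \<theta>) = cis \<theta> *
      (Complex (1 - \<beta> * cos (\<theta> + \<alpha>)) (\<beta> * sin (\<theta> + \<alpha>)) / Complex (1 - \<beta> * cos (\<theta> + \<alpha>)) (- (\<beta> * sin (\<theta> + \<alpha>))))"
    using mult_cos_less_1[OF assms(1,2), of "\<theta> + \<alpha>"]
    by (simp add: oa_phase_def cis_mult[symmetric] cis_2_arctan_divide)
  also have "Complex (1 - \<beta> * cos (\<theta> + \<alpha>)) (\<beta> * sin (\<theta> + \<alpha>)) = 1 - a * cis (- \<theta>)"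
    by (simp add: a complex_eq_iff)
  also have "Complex (1 - \<beta> * cos (\<theta> + \<alpha>)) (- (\<beta> * sin (\<theta> + \<alpha>))) = 1 - cnj a * cis \<theta>"
    by (simp add: a complex_eq_iff)
  also have "cis \<theta> * ((1 - a * cis (- \<theta>)) / (1 - cnj a * cis \<theta>)) = (cis \<theta> - a) / (1 - cnj a * cis \<theta>)"
  proof -
    have "cis \<theta> * (1 - a * cis (- \<theta>)) = cis \<theta> - a * (cis \<theta> * cis (- \<theta>))"
      by (simp add: algebra_simps)
    then show ?thesis by (simp add: cis_mult)
  qed
  finally show ?thesis .
qed

lemma oa_state_eq:
  assumes "0 \<le> \<beta>" "\<beta> < 1"
  shows "oa_state q \<alpha> \<beta> = disc_state q (oa_coordinate \<alpha> \<beta>)"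
proof (rule extensionalityI[of _ "{0..1}"])
  show "oa_state q \<alpha> \<beta> \<in> extensional {0..1}" "disc_state q (oa_coordinate \<alpha> \<beta>) \<in> extensional {0..1}"
    by (simp_all add: oa_state_def disc_state_def)
  fix \<xi> :: real assume \<xi>: "\<xi> \<in> {0..1}"
  define a where "a = oa_coordinate \<alpha> \<beta>"
  define v where "v = circle_point q \<xi>"
  define s where "s = \<xi> + oa_shift \<alpha> \<beta> + q / (2 * pi)"
  have a: "norm a < 1"
    using assms by (simp add: a_def norm_oa_coordinate)
  obtain \<theta> where \<theta>: "oa_cdf_inv \<alpha> \<beta> s = to_angle \<theta>"
      "oa_phase \<alpha> \<beta> \<theta> = oa_phase \<alpha> \<beta> 0 + 2 * pi * frac s"
    using oa_cdf_inv_eq[OF assms] by blast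
  \<comment> \<open>The shift cancels the value of the phase at 0, and reading s modulo 1 costs a
    multiple of 2 pi, invisible to \<open>cis\<close>.\<close>
  have "oa_phase \<alpha> \<beta> \<theta> = 2 * pi * \<xi> + q - 2 * pi * of_int \<lfloor>s\<rfloor>"
    unfolding \<theta>(2) oa_phase_0 frac_def by (simp add: s_def field_simps)
  then have "cis (oa_phase \<alpha> \<beta> \<theta>) = v"
    by (simp add: v_def circle_point_def flip: cis_divide)
  then have "v = (cis \<theta> - a) / (1 - cnj a * cis \<theta>)"
    using cis_oa_phase[OF assms, of \<alpha> \<theta>] by (simp add: a_def)
  moreover have "1 - cnj a * cis \<theta> \<noteq> 0"
    using disc_denominator_nonzero[of "cnj a" "- cis \<theta>"] a by simp
  ultimately have "v * (1 - cnj a * cis \<theta>) = cis \<theta> - a"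
    by (simp add: field_simps)
  then have "cis \<theta> * (1 + cnj a * v) = v + a"
    by (simp add: algebra_simps)
  moreover have "1 + cnj a * v \<noteq> 0"
    using disc_denominator_nonzero[of "cnj a" v] a by (simp add: v_def)
  ultimately have "cis \<theta> = (v + a) / (1 + cnj a * v)"
    by (simp add: field_simps)
  then have "cis_angle (to_angle \<theta>) = cis_angle (disc_state q a \<xi>)"
    using cis_disc_state[OF a \<xi>, of q] by (simp add: v_def)
  then have "to_angle \<theta> = disc_state q a \<xi>"
    by (simp only: cis_angle_eq_iff)
  then show "oa_state q \<alpha> \<beta> \<xi> = disc_state q (oa_coordinate \<alpha> \<beta>) \<xi>"
    using \<xi> \<theta>(1) by (simp add: oa_state_def s_def a_def)
qed

lemma oa_states_eq_disc_states:
  "{oa_state q \<alpha> \<beta> | \<alpha> \<beta>. \<beta> \<in> {0..<1} \<and> \<alpha> \<in> {-pi..pi}} = disc_states q"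
proof (intro equalityI subsetI)
  fix x assume "x \<in> disc_states q"
  then obtain a where a: "norm a < 1" "x = disc_state q a"
    by (auto simp: disc_states_def)
  have "oa_coordinate (- Arg a) (norm a) = a"
    by (simp add: oa_coordinate_def rcis_cmod_Arg flip: rcis_def)
  then have "x = oa_state q (- Arg a) (norm a)"
    using a oa_state_eq[of "norm a" q "- Arg a"] by simp
  moreover have "- Arg a \<in> {-pi..pi}"
    using Arg_bounded[of a] by auto
  moreover have "norm a \<in> {0..<1}"
    using a by simp
  ultimately show "x \<in> {oa_state q \<alpha> \<beta> | \<alpha> \<beta>. \<beta> \<in> {0..<1} \<and> \<alpha> \<in> {-pi..pi}}"
    by blast
qed (auto simp: disc_states_def oa_state_eq norm_oa_coordinate)

section \<open>Evolution of the parameters on the manifold\<close>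

lemma kuramoto_solution_cong:
  assumes "\<And>t. t \<in> T \<Longrightarrow> x t = y t"
  shows "kuramoto_solution T x \<longleftrightarrow> kuramoto_solution T y"
proof -
  have "has_state_derivative x V (at t within T) t \<longleftrightarrow> has_state_derivative y V (at t within T) t"
    if "t \<in> T" for t V
  proof -
    have "(\<forall>\<^sub>F s in at t within T. \<forall>\<xi>\<in>{0..1}. x s \<xi> = x t \<xi> + to_angle (h s \<xi>)) \<longleftrightarrow>
        (\<forall>\<^sub>F s in at t within T. \<forall>\<xi>\<in>{0..1}. y s \<xi> = y t \<xi> + to_angle (h s \<xi>))" for h
      unfolding eventually_at_filter
      by (intro eventually_cong always_eventually allI) (use assms that in auto)
    then show ?thesis unfolding has_state_derivative_def by simp
  qed
  then show ?thesis
    using assms by (simp add: kuramoto_solution_def cong: ball_cong)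
qed

lemma kuramoto_solution_oa_state:
  assumes "oa_parameter_solution T \<alpha> \<beta>"
  shows "kuramoto_solution T (\<lambda>t. oa_state q (\<alpha> t) (\<beta> t))"
proof -
  have \<beta>: "0 \<le> \<beta> t" "\<beta> t < 1" if "t \<in> T" for t
    using assms that by (auto simp: oa_parameter_solution_def)
  have "kuramoto_solution T (\<lambda>t. disc_state q (oa_coordinate (\<alpha> t) (\<beta> t)))"
  proof (rule kuramoto_solution_disc_state)
    fix t assume t: "t \<in> T"
    show "norm (oa_coordinate (\<alpha> t) (\<beta> t)) < 1"
      using \<beta>[OF t] by (simp add: norm_oa_coordinate)
    define \<beta>' where "\<beta>' = 1 / 2 * \<beta> t * (1 - (\<beta> t)\<^sup>2)"
    have d: "(\<beta> has_real_derivative \<beta>') (at t within T)" "(\<alpha> has_real_derivative 0) (at t within T)"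
      using assms t by (auto simp: oa_parameter_solution_def \<beta>'_def)
    have "((\<lambda>t. oa_coordinate (\<alpha> t) (\<beta> t)) has_vector_derivative of_real \<beta>' * cis (- \<alpha> t)) (at t within T)"
      unfolding has_vector_derivative_complex_iff oa_coordinate_def
      by (auto intro!: derivative_eq_intros d)
    moreover have "of_real \<beta>' * cis (- \<alpha> t) =
        oa_coordinate (\<alpha> t) (\<beta> t) * of_real (1 - (norm (oa_coordinate (\<alpha> t) (\<beta> t)))\<^sup>2) / 2"
      unfolding norm_oa_coordinate[OF \<beta>(1)[OF t]] by (simp add: oa_coordinate_def \<beta>'_def)
    ultimately show "((\<lambda>t. oa_coordinate (\<alpha> t) (\<beta> t)) has_vector_derivative
        oa_coordinate (\<alpha> t) (\<beta> t) * of_real (1 - (norm (oa_coordinate (\<alpha> t) (\<beta> t)))\<^sup>2) / 2) (at t within T)"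
      by simp
  qed
  then show ?thesis
    by (rule kuramoto_solution_cong[THEN iffD1, rotated]) (simp add: oa_state_eq \<beta>)
qed

section \<open>The mean-field equation\<close>

lemma continuous_on_oa_density:
  assumes "0 \<le> \<beta>" "\<beta> < 1"
  shows "continuous_on A (oa_density \<alpha> \<beta>)"
proof -
  have "1 - 2 * \<beta> * cos (\<alpha> + \<theta>) + \<beta>\<^sup>2 \<noteq> 0" for \<theta>
    using poisson_denominator_pos[OF assms, of "\<alpha> + \<theta>"] by simp
  then show ?thesis
    unfolding oa_density_def[abs_def] by (intro continuous_intros) auto
qed

text \<open>Partial fractions of the Poisson kernel: the first summand is holomorphic in
  \<open>u\<close> near the closed disc, the second in \<open>cnj u\<close>, so that both can be
  averaged by the mean value property.\<close>

lemma oa_density_circle_point: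
  fixes \<alpha> \<beta> \<xi> :: real
  assumes "0 \<le> \<beta>" "\<beta> < 1"
  defines "a \<equiv> oa_coordinate \<alpha> \<beta>"
  defines "u \<equiv> circle_point 0 \<xi>"
  shows "of_real (2 * pi * oa_density \<alpha> \<beta> (2 * pi * \<xi>)) =
    1 / (1 - cnj a * u) + a * cnj u / (1 - a * cnj u)"
proof -
  define z where "z = cnj a * u"
  have a: "norm a < 1" using assms by (simp add: a_def norm_oa_coordinate)
  have z: "z = of_real \<beta> * cis (\<alpha> + 2 * pi * \<xi>)"
    by (simp add: z_def a_def u_def circle_point_def oa_coordinate_def cis_cnj cis_mult)
  have nz: "1 - z \<noteq> 0" "1 - cnj z \<noteq> 0"
    using disc_denominator_nonzero[of "cnj a" "- u"] disc_denominator_nonzero[of a "- cnj u"] a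
    by (simp_all add: z_def u_def)
  have "norm z = \<beta>"
    using assms(1) by (simp add: z norm_mult)
  then have norm_z: "z * cnj z = of_real (\<beta>\<^sup>2)"
    using complex_norm_square[of z] by simp
  have "(1 - z) * (1 - cnj z) = of_real (1 - 2 * \<beta> * cos (\<alpha> + 2 * pi * \<xi>) + \<beta>\<^sup>2)"
  proof -
    have "(1 - z) * (1 - cnj z) = 1 - (z + cnj z) + z * cnj z"
      by (simp add: algebra_simps)
    also have "z + cnj z = of_real (2 * \<beta> * cos (\<alpha> + 2 * pi * \<xi>))"
      unfolding complex_add_cnj by (simp add: z)
    finally show ?thesis
      unfolding norm_z by simp
  qed
  then have "of_real (2 * pi * oa_density \<alpha> \<beta> (2 * pi * \<xi>)) = (1 - z * cnj z) / ((1 - z) * (1 - cnj z))"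
    by (simp add: oa_density_def norm_z)
  also have "\<dots> = 1 / (1 - z) + cnj z / (1 - cnj z)"
    using nz by (simp add: field_simps)
  finally show ?thesis by (simp add: z_def)
qed

text \<open>The sine is the imaginary part of \<open>cis \<theta> * cis (- \<phi>)\<close>, so the
  integral is read off from the first Fourier coefficient of the density, which is
  \<open>cnj a\<close>. The summand in \<open>cnj u\<close> contributes nothing: after
  multiplication by \<open>cnj u\<close> it still vanishes at 0.\<close>

lemma oa_density_sin_integral:
  assumes "0 \<le> \<beta>" "\<beta> < 1"
  shows "integral {0..2 * pi} (\<lambda>\<phi>. oa_density \<alpha> \<beta> \<phi> * sin (\<theta> - \<phi>)) = \<beta> * sin (\<alpha> + \<theta>)"
proof -
  define a where "a = oa_coordinate \<alpha> \<beta>"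
  define u where "u = circle_point 0"
  have a: "norm a < 1" using assms by (simp add: a_def norm_oa_coordinate)
  have nz: "1 - cnj a * z \<noteq> 0" "1 - a * z \<noteq> 0" if "norm z \<le> 1" for z
    using disc_denominator_nonzero[of "cnj a" "- z"] disc_denominator_nonzero[of a "- z"] a that by simp_all
  have "((\<lambda>\<xi>. 1 / (1 - cnj a * u \<xi>) * cnj (u \<xi>)) has_integral cnj a / (1 - cnj a * 0)) {0..1}"
    unfolding u_def
  proof (rule circle_mean_first_coefficient)
    show "(\<lambda>z. cnj a / (1 - cnj a * z)) holomorphic_on cball 0 1"
      using nz by (intro holomorphic_intros) auto
    show "1 / (1 - cnj a * z) = 1 + z * (cnj a / (1 - cnj a * z))" if "norm z = 1" for z
      using nz[of z] that by (simp add: field_simps)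
  qed
  moreover have "((\<lambda>\<xi>. a * (cnj (u \<xi>))\<^sup>2 / (1 - a * cnj (u \<xi>))) has_integral a * 0\<^sup>2 / (1 - a * 0)) {0..1}"
    unfolding u_def
    by (rule circle_mean_cnj[of "\<lambda>z. a * z\<^sup>2 / (1 - a * z)"])
      (use nz in \<open>auto intro!: holomorphic_intros\<close>)
  ultimately have "((\<lambda>\<xi>. 1 / (1 - cnj a * u \<xi>) * cnj (u \<xi>) + a * (cnj (u \<xi>))\<^sup>2 / (1 - a * cnj (u \<xi>)))
      has_integral cnj a / (1 - cnj a * 0) + a * 0\<^sup>2 / (1 - a * 0)) {0..1}"
    by (rule has_integral_add)
  then have "((\<lambda>\<xi>. of_real (2 * pi * oa_density \<alpha> \<beta> (2 * pi * \<xi>)) * cnj (u \<xi>)) has_integral cnj a) {0..1}"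
    by (rule has_integral_eq_rhs[OF has_integral_eq[rotated]])
      (simp_all only: oa_density_circle_point[OF assms] a_def u_def,
       simp_all add: power2_eq_square distrib_right)
  from has_integral_linear[OF has_integral_mult_right[OF this, of "cis \<theta>"] bounded_linear_Im]
  have "((\<lambda>\<xi>. 2 * pi * oa_density \<alpha> \<beta> (2 * pi * \<xi>) * sin (\<theta> - 2 * pi * \<xi>)) has_integral Im (cis \<theta> * cnj a)) {0..1}"
    by (rule has_integral_eq[rotated])
      (simp add: o_def u_def circle_point_def sin_diff algebra_simps)
  also have "Im (cis \<theta> * cnj a) = \<beta> * sin (\<alpha> + \<theta>)"
    by (simp add: a_def oa_coordinate_def sin_add algebra_simps)
  finally have "((\<lambda>\<xi>. 2 * pi * oa_density \<alpha> \<beta> (2 * pi * \<xi>) * sin (\<theta> - 2 * pi * \<xi>)) has_integral \<beta> * sin (\<alpha> + \<theta>)) {0..1}" .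
  from has_integral_stretch_real[OF this, of "1 / (2 * pi)"]
  have "((\<lambda>\<phi>. 2 * pi * oa_density \<alpha> \<beta> \<phi> * sin (\<theta> - \<phi>)) has_integral 2 * pi * (\<beta> * sin (\<alpha> + \<theta>)))
      ((\<lambda>x. x * (2 * pi)) ` {0..1})"
    by simp
  moreover have "(\<lambda>x. x * (2 * pi)) ` {0..1} = {0..2 * pi}"
    using image_mult_atLeastAtMost[of "2 * pi" 0 1] by (simp add: mult.commute[of _ "2 * pi"])
  ultimately have "((\<lambda>\<phi>. 2 * pi * oa_density \<alpha> \<beta> \<phi> * sin (\<theta> - \<phi>)) has_integral 2 * pi * (\<beta> * sin (\<alpha> + \<theta>)))
      {0..2 * pi}" by simp
  from has_integral_divide[OF this, of "2 * pi"]
  show ?thesis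
    by (simp add: integral_unique mult.assoc)
qed

lemma mean_field_solution_oa_density:
  assumes "oa_parameter_solution T \<alpha> \<beta>"
  shows "mean_field_solution T (\<lambda>t. oa_density (\<alpha> t) (\<beta> t))"
  unfolding mean_field_solution_def
proof (intro ballI conjI allI)
  fix t assume t: "t \<in> T"
  have \<beta>: "0 \<le> \<beta> t" "\<beta> t < 1"
    using assms t by (auto simp: oa_parameter_solution_def)
  show "oa_density (\<alpha> t) (\<beta> t) (\<theta> + 2 * pi) = oa_density (\<alpha> t) (\<beta> t) \<theta>" for \<theta>
    using cos_periodic[of "\<alpha> t + \<theta>"] by (simp add: oa_density_def add.assoc)
  show "oa_density (\<alpha> t) (\<beta> t) absolutely_integrable_on {0..2 * pi}"
    by (intro absolutely_integrable_continuous_real continuous_on_oa_density \<beta>)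
  fix \<theta>
  define b where "b = \<beta> t"
  define s c where "s = sin (\<alpha> t + \<theta>)" and "c = cos (\<alpha> t + \<theta>)"
  define k where "k = 1 - 2 * b * c + b\<^sup>2"
  have k: "0 < k"
    unfolding k_def b_def c_def by (rule poisson_denominator_pos[OF \<beta>])
  have s2: "s * s = 1 - c * c"
    by (simp add: s_def c_def sin_squared_eq flip: power2_eq_square)
  define b' where "b' = 1 / 2 * b * (1 - b\<^sup>2)"
  have d: "(\<beta> has_real_derivative b') (at t within T)" "(\<alpha> has_real_derivative 0) (at t within T)"
    using assms t by (auto simp: oa_parameter_solution_def b'_def b_def)
  define D where "D = 1 / (2 * pi) * ((- (2 * b * b') * k - (1 - b\<^sup>2) * (2 * b * b' - 2 * b' * c)) / (k * k))"
  have time: "((\<lambda>s. oa_density (\<alpha> s) (\<beta> s) \<theta>) has_real_derivative D) (at t within T)"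
    unfolding oa_density_def D_def
  proof (rule DERIV_cmult)
    show "((\<lambda>s. (1 - (\<beta> s)\<^sup>2) / (1 - 2 * \<beta> s * cos (\<alpha> s + \<theta>) + (\<beta> s)\<^sup>2)) has_real_derivative
        (- (2 * b * b') * k - (1 - b\<^sup>2) * (2 * b * b' - 2 * b' * c)) / (k * k)) (at t within T)"
      using k by (auto intro!: derivative_eq_intros d
        simp: b_def[symmetric] c_def[symmetric] s_def[symmetric] k_def[symmetric])
  qed
  have "((\<lambda>\<theta>. 1 / (2 * pi) * ((1 - b\<^sup>2) * (b * sin (\<alpha> t + \<theta>)) / (1 - 2 * b * cos (\<alpha> t + \<theta>) + b\<^sup>2)))
      has_real_derivative
      1 / (2 * pi) * (((1 - b\<^sup>2) * (b * c) * k - (1 - b\<^sup>2) * (b * s) * (2 * b * s)) / (k * k))) (at \<theta>)"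
  proof (rule DERIV_cmult)
    show "((\<lambda>\<theta>. (1 - b\<^sup>2) * (b * sin (\<alpha> t + \<theta>)) / (1 - 2 * b * cos (\<alpha> t + \<theta>) + b\<^sup>2))
        has_real_derivative ((1 - b\<^sup>2) * (b * c) * k - (1 - b\<^sup>2) * (b * s) * (2 * b * s)) / (k * k)) (at \<theta>)"
      using k by (auto intro!: derivative_eq_intros simp: c_def[symmetric] s_def[symmetric] k_def[symmetric])
  qed
  \<comment> \<open>Both sides equal \<open>b (1 - b^2) ((1 + b^2) c - 2 b)\<close> once
    \<open>s^2\<close> is replaced by \<open>1 - c^2\<close>.\<close>
  moreover have "(1 - b\<^sup>2) * (b * c) * k - (1 - b\<^sup>2) * (b * s) * (2 * b * s)
        = - (2 * b * b') * k - (1 - b\<^sup>2) * (2 * b * b' - 2 * b' * c)"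
  proof -
    have "(1 - b\<^sup>2) * (b * s) * (2 * b * s) = (1 - b\<^sup>2) * (2 * b * b * (1 - c * c))"
      by (simp flip: s2)
    then show ?thesis
      unfolding k_def b'_def by (simp add: power2_eq_square field_simps)
  qed
  ultimately have space: "((\<lambda>\<theta>. oa_density (\<alpha> t) (\<beta> t) \<theta> *
      integral {0..2 * pi} (\<lambda>\<phi>. oa_density (\<alpha> t) (\<beta> t) \<phi> * sin (\<theta> - \<phi>))) has_real_derivative D) (at \<theta>)"
    unfolding oa_density_sin_integral[OF \<beta>] D_def by (simp add: oa_density_def b_def)
  show "\<exists>D. ((\<lambda>s. oa_density (\<alpha> s) (\<beta> s) \<theta>) has_real_derivative D) (at t within T) \<and>
      ((\<lambda>\<theta>. oa_density (\<alpha> t) (\<beta> t) \<theta> *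
        integral {0..2 * pi} (\<lambda>\<phi>. oa_density (\<alpha> t) (\<beta> t) \<phi> * sin (\<theta> - \<phi>))) has_real_derivative D) (at \<theta>)"
    using time space by blast
qed

section \<open>Cross ratios and moments of Moebius images\<close>

lemma norm_cis_minus_linear_le:
  fixes h :: real
  shows "norm (cis h - 1 - \<i> * of_real h) \<le> h\<^sup>2"
  using Taylor_exp[of "\<i> * of_real h" 1]
  by (simp add: cis_conv_exp norm_mult power2_eq_square diff_diff_eq)

text \<open>Since \<open>cis h - 1\<close> is \<open>\<i> h\<close> up to an error of order
  \<open>h^2\<close>, the derivative of a circle-valued curve passes to one of bounded complex
  functions. Uniformity in \<xi> is kept because integrals over \<xi> are to be
  differentiated.\<close>

lemma cis_state_derivative:
  assumes deriv: "has_state_derivative x V (at t within T) t"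
    and V: "\<And>\<xi>. \<xi> \<in> {0..1} \<Longrightarrow> \<bar>V \<xi>\<bar> \<le> 1"
  shows "uniform_limit {0..1} (\<lambda>s \<xi>. (cis_angle (x s \<xi>) - cis_angle (x t \<xi>)) / of_real (s - t))
    (\<lambda>\<xi>. \<i> * of_real (V \<xi>) * cis_angle (x t \<xi>)) (at t within T)"
proof (rule uniform_limitI)
  fix e :: real assume e: "0 < e"
  obtain h where h: "\<forall>\<^sub>F s in at t within T. \<forall>\<xi>\<in>{0..1}. x s \<xi> = x t \<xi> + to_angle (h s \<xi>)"
      and lim: "uniform_limit {0..1} (\<lambda>s \<xi>. h s \<xi> / (s - t)) V (at t within T)"
    using deriv by (auto simp: has_state_derivative_def)
  have "((\<lambda>s. \<bar>s - t\<bar>) \<longlongrightarrow> \<bar>t - t\<bar>) (at t within T)"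
    by (intro tendsto_intros)
  \<comment> \<open>A difference quotient within 1 of V has size at most 2, so the quadratic error
    is at most \<open>4 |s - t|\<close>; the bound e / 8 makes it less than e / 2.\<close>
  then have "\<forall>\<^sub>F s in at t within T. \<bar>s - t\<bar> < e / 8"
    using e by (intro order_tendstoD(2)[of _ 0]) auto
  moreover have "\<forall>\<^sub>F s in at t within T. s \<noteq> t"
    by (simp add: eventually_at_filter)
  moreover have "\<forall>\<^sub>F s in at t within T. \<forall>\<xi>\<in>{0..1}. dist (h s \<xi> / (s - t)) (V \<xi>) < min 1 (e / 2)"
    using e by (intro uniform_limitD[OF lim]) auto
  ultimately show "\<forall>\<^sub>F s in at t within T. \<forall>\<xi>\<in>{0..1}.
      dist ((cis_angle (x s \<xi>) - cis_angle (x t \<xi>)) / of_real (s - t)) (\<i> * of_real (V \<xi>) * cis_angle (x t \<xi>)) < e"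
    using h
  proof eventually_elim
    case (elim s)
    show ?case
    proof
      fix \<xi> :: real assume \<xi>: "\<xi> \<in> {0..1}"
      define \<delta> where "\<delta> = s - t"
      define g where "g = h s \<xi> / \<delta>"
      have \<delta>: "\<delta> \<noteq> 0" "\<bar>\<delta>\<bar> < e / 8" using elim by (auto simp: \<delta>_def)
      have gV: "\<bar>g - V \<xi>\<bar> < 1" "\<bar>g - V \<xi>\<bar> < e / 2"
        using elim(3) \<xi> by (auto simp: g_def \<delta>_def dist_real_def)
      have "\<bar>g\<bar> \<le> 2" using gV V[OF \<xi>] by linarith
      then have "\<bar>g\<bar>\<^sup>2 \<le> 2\<^sup>2" by (intro power_mono) auto
      have hg: "h s \<xi> = g * \<delta>" using \<delta> by (simp add: g_def)
      define R where "R = cis (h s \<xi>) - 1 - \<i> * of_real (h s \<xi>)"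
      have "norm R / \<bar>\<delta>\<bar> \<le> (g * \<delta>)\<^sup>2 / \<bar>\<delta>\<bar>"
        unfolding R_def hg by (intro divide_right_mono norm_cis_minus_linear_le) auto
      also have "(g * \<delta>)\<^sup>2 = \<bar>g\<bar>\<^sup>2 * \<bar>\<delta>\<bar> * \<bar>\<delta>\<bar>"
        by (simp add: power_mult_distrib power2_eq_square)
      also have "\<dots> / \<bar>\<delta>\<bar> = \<bar>g\<bar>\<^sup>2 * \<bar>\<delta>\<bar>"
        using \<delta> by simp
      also have "\<dots> \<le> 2\<^sup>2 * \<bar>\<delta>\<bar>"
        using \<open>\<bar>g\<bar>\<^sup>2 \<le> 2\<^sup>2\<close> by (intro mult_right_mono) auto
      also have "\<dots> < e / 2" using \<delta> by simp
      finally have R: "norm R / \<bar>\<delta>\<bar> < e / 2" .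
      have "cis_angle (x s \<xi>) = cis_angle (x t \<xi>) * cis (h s \<xi>)"
        using elim(4) \<xi> by (simp add: cis_angle_add)
      then have "(cis_angle (x s \<xi>) - cis_angle (x t \<xi>)) / of_real \<delta> - \<i> * of_real (V \<xi>) * cis_angle (x t \<xi>)
          = cis_angle (x t \<xi>) * (\<i> * of_real (g - V \<xi>) + R / of_real \<delta>)"
        using \<delta> by (simp add: R_def hg field_simps)
      then have "dist ((cis_angle (x s \<xi>) - cis_angle (x t \<xi>)) / of_real \<delta>) (\<i> * of_real (V \<xi>) * cis_angle (x t \<xi>))
          = norm (\<i> * of_real (g - V \<xi>) + R / of_real \<delta>)"
        by (simp add: dist_norm norm_mult)
      also have "\<dots> \<le> \<bar>g - V \<xi>\<bar> + norm R / \<bar>\<delta>\<bar>"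
        by (rule order.trans[OF norm_triangle_ineq]) (simp add: norm_mult norm_divide flip: of_real_diff)
      also have "\<dots> < e" using R gV by linarith
      finally show "dist ((cis_angle (x s \<xi>) - cis_angle (x t \<xi>)) / of_real (s - t))
          (\<i> * of_real (V \<xi>) * cis_angle (x t \<xi>)) < e"
        by (simp add: \<delta>_def)
    qed
  qed
qed

lemma has_vector_derivative_iff_quotient:
  fixes f :: "real \<Rightarrow> complex"
  shows "(f has_vector_derivative f') (at t within T) \<longleftrightarrow>
    ((\<lambda>s. (f s - f t) / of_real (s - t)) \<longlongrightarrow> f') (at t within T)"
proof -
  have eq: "norm (f s - f t - (s - t) *\<^sub>R f') / norm (s - t) = norm ((f s - f t) / of_real (s - t) - f')"
    if "s \<noteq> t" for s
  proof -
    have "(f s - f t) / of_real (s - t) - f' = (f s - f t - (s - t) *\<^sub>R f') / of_real (s - t)"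
      using that by (simp add: diff_divide_distrib scaleR_conv_of_real)
    then show ?thesis by (simp add: norm_divide del: of_real_diff)
  qed
  have "(f has_vector_derivative f') (at t within T) \<longleftrightarrow>
      ((\<lambda>s. norm (f s - f t - (s - t) *\<^sub>R f') / norm (s - t)) \<longlongrightarrow> 0) (at t within T)"
    unfolding has_vector_derivative_def has_derivative_iff_norm
    by (simp add: bounded_linear_scaleR_left)
  also have "\<dots> \<longleftrightarrow> ((\<lambda>s. norm ((f s - f t) / of_real (s - t) - f')) \<longlongrightarrow> 0) (at t within T)"
  proof (rule tendsto_cong)
    show "\<forall>\<^sub>F s in at t within T. norm (f s - f t - (s - t) *\<^sub>R f') / norm (s - t) =
        norm ((f s - f t) / of_real (s - t) - f')"
      unfolding eventually_at_filter by (intro always_eventually allI impI eq)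
  qed
  also have "\<dots> \<longleftrightarrow> ((\<lambda>s. (f s - f t) / of_real (s - t)) \<longlongrightarrow> f') (at t within T)"
    by (simp add: tendsto_norm_zero_iff LIM_zero_iff)
  finally show ?thesis .
qed

text \<open>Differentiation under the integral: on an interval of length 1, with a weight bounded by
  1, a uniform error of the difference quotients bounds the error of the integrals.\<close>

lemma has_vector_derivative_integral_uniform:
  fixes w :: "real \<Rightarrow> real \<Rightarrow> complex"
  assumes lim: "uniform_limit {0..1} (\<lambda>s \<xi>. (w s \<xi> - w t \<xi>) / of_real (s - t)) w' (at t within T)"
    and t: "t \<in> T"
    and w: "\<And>s. s \<in> T \<Longrightarrow> ((\<lambda>\<xi>. w s \<xi> * g \<xi>) has_integral I s) {0..1}"
    and w': "((\<lambda>\<xi>. w' \<xi> * g \<xi>) has_integral I') {0..1}"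
    and g: "\<And>\<xi>. \<xi> \<in> {0..1} \<Longrightarrow> norm (g \<xi>) \<le> 1"
  shows "(I has_vector_derivative I') (at t within T)"
  unfolding has_vector_derivative_iff_quotient
proof (rule tendstoI)
  fix e :: real assume e: "0 < e"
  then have "\<forall>\<^sub>F s in at t within T. \<forall>\<xi>\<in>{0..1}. dist ((w s \<xi> - w t \<xi>) / of_real (s - t)) (w' \<xi>) < e / 2"
    by (intro uniform_limitD[OF lim]) simp
  moreover have "\<forall>\<^sub>F s in at t within T. s \<in> T"
    by (simp add: eventually_at_filter)
  ultimately show "\<forall>\<^sub>F s in at t within T. dist ((I s - I t) / of_real (s - t)) I' < e"
  proof eventually_elim
    case (elim s)
    have "((\<lambda>\<xi>. (w s \<xi> * g \<xi> - w t \<xi> * g \<xi>) / of_real (s - t) - w' \<xi> * g \<xi>) has_integral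
        (I s - I t) / of_real (s - t) - I') (cbox 0 1)"
      unfolding box_real
      by (intro has_integral_diff has_integral_divide w w' t elim)
    moreover have "norm ((w s \<xi> * g \<xi> - w t \<xi> * g \<xi>) / of_real (s - t) - w' \<xi> * g \<xi>) \<le> e / 2" if "\<xi> \<in> cbox 0 1" for \<xi>
    proof -
      have "norm ((w s \<xi> - w t \<xi>) / of_real (s - t) - w' \<xi>) * norm (g \<xi>) \<le> e / 2 * 1"
        using elim(1) g[of \<xi>] that e by (intro mult_mono) (auto simp: dist_norm less_imp_le)
      then show ?thesis
        by (simp add: left_diff_distrib diff_divide_distrib flip: norm_mult)
    qed
    ultimately have "norm ((I s - I t) / of_real (s - t) - I') \<le> e / 2 * measure lborel (cbox 0 (1::real))"
      using e by (intro has_integral_bound) auto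
    then show ?case using e by (simp add: dist_norm)
  qed
qed

section \<open>Linear equations on the negative half-line\<close>

text \<open>The quantity \<open>|y|^2 e^(2t)\<close> has derivative \<open>2 (Re c + 1)\<close>
  times itself, which is nonnegative by the bound on c. It is positive far in the past because the
  limit is nonzero, and so it stays positive.\<close>

lemma linear_ode_nonzero:
  fixes y c :: "real \<Rightarrow> complex"
  assumes deriv: "\<And>t. t \<le> 0 \<Longrightarrow> (y has_vector_derivative c t * y t) (at t within {..0})"
    and c: "\<And>t. t \<le> 0 \<Longrightarrow> norm (c t) \<le> 1"
    and lim: "(y \<longlongrightarrow> L) at_bot" "L \<noteq> 0"
    and t: "t \<le> 0"
  shows "y t \<noteq> 0"
proof -
  define N where "N t = (norm (y t))\<^sup>2 * exp (2 * t)" for t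
  have N: "N t = ((Re (y t))\<^sup>2 + (Im (y t))\<^sup>2) * exp (2 * t)" for t
    by (simp add: N_def cmod_power2)
  have "\<forall>\<^sub>F s in at_bot. y s \<noteq> 0"
    using lim by (rule tendsto_imp_eventually_ne)
  then obtain s0 where s0: "\<And>s. s \<le> s0 \<Longrightarrow> y s \<noteq> 0"
    by (auto simp: eventually_at_bot_linorder)
  define s where "s = min s0 t"
  have "N s \<le> N t"
  proof (rule DERIV_nonneg_imp_increasing_open[where f = N])
    define N' where "N' u = 2 * (Re (c u) + 1) * N u" for u
    have N': "(N has_real_derivative N' u) (at u within {..0})" if "u \<le> 0" for u
    proof -
      have d: "((\<lambda>t. Re (y t)) has_real_derivative Re (c u * y u)) (at u within {..0})"
          "((\<lambda>t. Im (y t)) has_real_derivative Im (c u * y u)) (at u within {..0})"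
        using deriv[OF that] by (simp_all add: has_vector_derivative_complex_iff)
      show ?thesis
      proof -
        define f g where "f = (\<lambda>t. Re (y t))" and "g = (\<lambda>t. Im (y t))"
        have "((\<lambda>t. ((f t)\<^sup>2 + (g t)\<^sup>2) * exp (2 * t)) has_real_derivative N' u) (at u within {..0})"
          by (auto intro!: derivative_eq_intros d[folded f_def g_def])
            (simp add: N'_def N f_def g_def power2_eq_square algebra_simps)
        then show ?thesis by (simp add: N[abs_def] f_def g_def)
      qed
    qed
    show "s \<le> t" by (simp add: s_def)
    show "\<exists>d. (N has_real_derivative d) (at u) \<and> 0 \<le> d" if "s < u" "u < t" for u
    proof -
      have "at u within {..0} = at u"
        using that t by (intro at_within_interior) auto
      then have "(N has_real_derivative N' u) (at u)"
        using N'[of u] that t by simp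
      moreover have "0 \<le> N' u"
        using c[of u] abs_Re_le_cmod[of "c u"] that t by (auto simp: N'_def N_def intro!: mult_nonneg_nonneg)
      ultimately show ?thesis by blast
    qed
    show "continuous_on {s..t} N"
      using t by (intro DERIV_continuous_on[of _ _ N'] has_field_derivative_subset[OF N']) auto
  qed
  moreover have "0 < N s"
    using s0[of s] by (simp add: N_def s_def)
  ultimately show ?thesis by (auto simp: N_def)
qed

text \<open>Two solutions of the same scalar linear equation have a constant quotient, and the limit
  in the past evaluates it. Conservation of cross ratios and reality of \<open>P\<close> are both
  instances.\<close>

lemma ratio_constant_limit:
  fixes y z c :: "real \<Rightarrow> complex"
  assumes y: "\<And>t. t \<le> 0 \<Longrightarrow> (y has_vector_derivative c t * y t) (at t within {..0})"
    and z: "\<And>t. t \<le> 0 \<Longrightarrow> (z has_vector_derivative c t * z t) (at t within {..0})"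
    and nz: "\<And>t. t \<le> 0 \<Longrightarrow> z t \<noteq> 0"
    and lim: "(y \<longlongrightarrow> Y) at_bot" "(z \<longlongrightarrow> Z) at_bot" "Z \<noteq> 0"
    and t: "t \<le> 0"
  shows "y t * Z = Y * z t"
proof -
  have "((\<lambda>t. y t / z t) has_vector_derivative 0) (at t within {..0})" if "t \<le> 0" for t
  proof -
    have "((\<lambda>t. inverse (z t)) has_vector_derivative c t * z t * - (inverse (z t) * inverse (z t))) (at t within {..0})"
      using field_vector_diff_chain_within[OF z[OF that] has_field_derivative_at_within[OF DERIV_inverse[OF nz[OF that]]]]
      by (simp add: o_def power2_eq_square)
    from has_vector_derivative_mult[OF y[OF that] this]
    moreover have "y t * (c t * z t * - (inverse (z t) * inverse (z t))) + c t * y t * inverse (z t) = 0"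
      using nz[OF that] by simp
    ultimately show ?thesis
      by (simp only: divide_inverse)
  qed
  then obtain K where K: "\<And>t. t \<le> 0 \<Longrightarrow> y t / z t = K"
    using has_vector_derivative_zero_constant[of "{..0}" "\<lambda>t. y t / z t"] by auto
  have "((\<lambda>t. y t / z t) \<longlongrightarrow> Y / Z) at_bot"
    by (intro tendsto_divide lim)
  moreover have "((\<lambda>t. y t / z t) \<longlongrightarrow> K) at_bot"
    by (rule tendsto_eventually) (auto simp: eventually_at_bot_linorder intro!: exI[of _ 0] K)
  ultimately have "Y / Z = K"
    by (intro tendsto_unique) auto
  then show ?thesis
    using K[OF t] nz[OF t] lim(3) by (simp add: field_simps)
qed

section \<open>Moebius transformations on the unit circle\<close>

text \<open>The relation is affine in v and in w separately, so collecting terms gives the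
  coefficients; the determinant factors as \<open>k * l * ((w1 - w3) * (v1 - v3))\<close>. The
  cross-multiplied form includes \<open>v = v3\<close>, where the quotient would have denominator
  0.\<close>

lemma moebius_of_cross_ratio:
  fixes v1 v2 v3 w1 w2 w3 :: complex
  assumes "v1 \<noteq> v2" "v2 \<noteq> v3" "v1 \<noteq> v3" "w1 \<noteq> w2" "w2 \<noteq> w3" "w1 \<noteq> w3"
  obtains A B C D where "A * D - B * C \<noteq> 0"
    "\<And>v w. (w - w1) * (w2 - w3) * ((v - v3) * (v2 - v1)) = (v - v1) * (v2 - v3) * ((w - w3) * (w2 - w1)) \<Longrightarrow>
      w * (C * v + D) = A * v + B"
proof -
  define k l where "k = (w2 - w3) * (v2 - v1)" and "l = (v2 - v3) * (w2 - w1)"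
  show ?thesis
  proof (rule that[of "w1 * k - w3 * l" "l * v1 - k * v3" "w3 * l * v1 - w1 * k * v3" "k - l"])
    have "(w1 * k - w3 * l) * (l * v1 - k * v3) - (w3 * l * v1 - w1 * k * v3) * (k - l)
        = k * l * ((w1 - w3) * (v1 - v3))"
      by (simp add: algebra_simps)
    also have "\<dots> \<noteq> 0"
      using assms by (simp add: k_def l_def)
    finally show "(w1 * k - w3 * l) * (l * v1 - k * v3) - (w3 * l * v1 - w1 * k * v3) * (k - l) \<noteq> 0" .
  next
    fix v w
    assume "(w - w1) * (w2 - w3) * ((v - v3) * (v2 - v1)) = (v - v1) * (v2 - v3) * ((w - w3) * (w2 - w1))"
    then have "(w - w1) * (v - v3) * k = (w - w3) * (v - v1) * l"
      by (simp add: k_def l_def mult_ac)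
    then show "w * ((k - l) * v + (l * v1 - k * v3)) = (w1 * k - w3 * l) * v + (w3 * l * v1 - w1 * k * v3)"
      by (simp add: algebra_simps)
  qed
qed

text \<open>The values \<open>w \<xi>\<close> are finite, so a zero of the denominator at a point of
  the circle would also be a zero of the numerator, and a common zero forces the determinant to
  vanish.\<close>

lemma moebius_denominator_nonzero:
  assumes det: "A * D - B * C \<noteq> (0::complex)"
    and eq: "\<And>\<xi>. \<xi> \<in> {0..1} \<Longrightarrow> w \<xi> * (C * circle_point q \<xi> + D) = A * circle_point q \<xi> + B"
    and z: "norm z = 1"
  shows "C * z + D \<noteq> 0"
proof
  assume 0: "C * z + D = 0"
  obtain \<xi> where \<xi>: "\<xi> \<in> {0..1}" "circle_point q \<xi> = z"
    using circle_point_surj[OF z] by blast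
  have "A * z + B = 0" using eq[OF \<xi>(1)] 0 \<xi> by simp
  then have "B = - (A * z)" "D = - (C * z)"
    using 0 by (simp_all add: add_eq_0_iff2 add_eq_0_iff)
  then show False using det by simp
qed

lemma linear_nonzero_cball:
  fixes C D z :: complex
  assumes "norm C < norm D" "norm z \<le> 1"
  shows "C * z + D \<noteq> 0"
proof
  assume "C * z + D = 0"
  then have "norm D = norm C * norm z"
    by (metis add_eq_0_iff norm_minus_cancel norm_mult)
  then show False
    using assms mult_left_le[of "norm z" "norm C"] by simp
qed

text \<open>Equal norms would put the pole \<open>- D / C\<close> on the circle. This leaves the
  dichotomy of a pole strictly inside or strictly outside the disc.\<close>

lemma moebius_denominator_norm_neq:
  assumes det: "A * D - B * C \<noteq> (0::complex)"
    and nz: "\<And>z. norm z = 1 \<Longrightarrow> C * z + D \<noteq> 0"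
  shows "norm C \<noteq> norm D"
proof
  assume eq: "norm C = norm D"
  show False
  proof (cases "C = 0")
    case True
    with eq det show False by simp
  next
    case False
    then have "norm (- D / C) = 1" "C * (- D / C) + D = 0"
      using eq by (auto simp: norm_divide)
    with nz show False by blast
  qed
qed

text \<open>If the pole of the transformation lies inside the disc, then it is a holomorphic function
  of \<open>cnj v\<close>, and the first Fourier coefficient vanishes. The relations between the moments
  are the same in both cases.\<close>

lemma moebius_moments:
  assumes det: "A * D - B * C \<noteq> (0::complex)"
    and eq: "\<And>\<xi>. \<xi> \<in> {0..1} \<Longrightarrow> w \<xi> * (C * circle_point q \<xi> + D) = A * circle_point q \<xi> + B"
  obtains Z P where
    "(w has_integral Z) {0..1}"
    "((\<lambda>\<xi>. w \<xi> * cnj (circle_point q \<xi>)) has_integral P) {0..1}"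
    "((\<lambda>\<xi>. (w \<xi>)\<^sup>2) has_integral Z\<^sup>2) {0..1}"
    "((\<lambda>\<xi>. (w \<xi>)\<^sup>2 * cnj (circle_point q \<xi>)) has_integral 2 * Z * P) {0..1}"
    "P \<noteq> 0 \<Longrightarrow> norm C < norm D \<and> P = (A * D - B * C) / D\<^sup>2"
proof (cases "norm C < norm D")
  case True
  define M where "M z = (A * z + B) / (C * z + D)" for z
  \<comment> \<open>The difference quotient of \<open>M\<close> at 0 with the factor z already
    cancelled, so its value at 0 is the derivative of \<open>M\<close>.\<close>
  define G where "G z = (A - C * M 0) / (C * z + D)" for z
  have nz: "C * z + D \<noteq> 0" if "norm z \<le> 1" for z
    using linear_nonzero_cball[OF True that] .
  have D: "D \<noteq> 0" using nz[of 0] by simp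
  have w: "w \<xi> = M (circle_point q \<xi>)" if "\<xi> \<in> {0..1}" for \<xi>
    using eq[OF that] nz[of "circle_point q \<xi>"] by (simp add: M_def eq_divide_eq)
  have hol: "M holomorphic_on cball 0 1" "G holomorphic_on cball 0 1"
    unfolding M_def[abs_def] G_def[abs_def] using nz by (auto intro!: holomorphic_intros)
  have MG: "M z = M 0 + z * G z" if "norm z = 1" for z
  proof -
    have "M 0 + z * G z = (M 0 * (C * z + D) + z * (A - C * M 0)) / (C * z + D)"
      using nz[of z] that by (simp add: G_def add_divide_distrib)
    also have "M 0 * (C * z + D) + z * (A - C * M 0) = A * z + B"
      using D by (simp add: M_def algebra_simps)
    finally show ?thesis by (simp add: M_def)
  qed
  have MG2: "(M z)\<^sup>2 = (M 0)\<^sup>2 + z * (G z * (M z + M 0))" if "norm z = 1" for z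
    using MG[OF that] by (simp add: power2_eq_square algebra_simps)
  show ?thesis
  proof (rule that[of "M 0" "G 0"])
    show "(w has_integral M 0) {0..1}"
      by (rule has_integral_eq[OF _ circle_mean[OF hol(1), of q]]) (simp add: w)
    show "((\<lambda>\<xi>. w \<xi> * cnj (circle_point q \<xi>)) has_integral G 0) {0..1}"
      by (rule has_integral_eq[OF _ circle_mean_first_coefficient[OF hol(2) MG, of q]]) (simp_all add: w)
    show "((\<lambda>\<xi>. (w \<xi>)\<^sup>2) has_integral (M 0)\<^sup>2) {0..1}"
      by (rule has_integral_eq[OF _ circle_mean[of "\<lambda>z. (M z)\<^sup>2" q]])
        (auto simp: w intro!: holomorphic_intros hol)
    have "(\<lambda>z. G z * (M z + M 0)) holomorphic_on cball 0 1"
      by (intro holomorphic_intros hol)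
    from circle_mean_first_coefficient[OF this MG2, of q]
    have "((\<lambda>\<xi>. (M (circle_point q \<xi>))\<^sup>2 * cnj (circle_point q \<xi>)) has_integral G 0 * (M 0 + M 0)) {0..1}"
      by simp
    then have "((\<lambda>\<xi>. (w \<xi>)\<^sup>2 * cnj (circle_point q \<xi>)) has_integral G 0 * (M 0 + M 0)) {0..1}"
      by (rule has_integral_eq[rotated]) (simp add: w)
    then show "((\<lambda>\<xi>. (w \<xi>)\<^sup>2 * cnj (circle_point q \<xi>)) has_integral 2 * M 0 * G 0) {0..1}"
      by (simp add: algebra_simps)
    show "norm C < norm D \<and> G 0 = (A * D - B * C) / D\<^sup>2"
      using True D by (simp add: G_def M_def power2_eq_square field_simps)
  qed
next
  case False
  have nz1: "C * z + D \<noteq> 0" if "norm z = 1" for z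
    using moebius_denominator_nonzero[OF det eq that] .
  then have CD: "norm D < norm C"
    using False moebius_denominator_norm_neq[OF det nz1] by simp
  \<comment> \<open>The transformation with \<open>1 / z\<close> substituted for z; on the circle
    \<open>1 / z\<close> is the conjugate, and the pole has moved outside the disc.\<close>
  define N where "N z = (B * z + A) / (D * z + C)" for z
  have nz: "D * z + C \<noteq> 0" if "norm z \<le> 1" for z
    using linear_nonzero_cball[OF CD that] .
  have w: "w \<xi> = N (cnj (circle_point q \<xi>))" if "\<xi> \<in> {0..1}" for \<xi>
    using eq[OF that] nz1[of "circle_point q \<xi>"]
    by (simp add: N_def cnj_circle_point divide_simps add.commute)
  have hol: "N holomorphic_on cball 0 1"
    unfolding N_def[abs_def] using nz by (auto intro!: holomorphic_intros)
  show ?thesis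
  proof (rule that[of "N 0" 0])
    show "(w has_integral N 0) {0..1}"
      by (rule has_integral_eq[OF _ circle_mean_cnj[OF hol, of q]]) (simp add: w)
    have "((\<lambda>\<xi>. N (cnj (circle_point q \<xi>)) * cnj (circle_point q \<xi>)) has_integral N 0 * 0) {0..1}"
      by (rule circle_mean_cnj[of "\<lambda>z. N z * z"]) (intro holomorphic_intros hol)
    then show "((\<lambda>\<xi>. w \<xi> * cnj (circle_point q \<xi>)) has_integral 0) {0..1}"
      by (rule has_integral_eq_rhs[OF has_integral_eq[rotated]]) (simp_all add: w)
    show "((\<lambda>\<xi>. (w \<xi>)\<^sup>2) has_integral (N 0)\<^sup>2) {0..1}"
      by (rule has_integral_eq[OF _ circle_mean_cnj[of "\<lambda>z. (N z)\<^sup>2" q]])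
        (auto simp: w intro!: holomorphic_intros hol)
    have "((\<lambda>\<xi>. (N (cnj (circle_point q \<xi>)))\<^sup>2 * cnj (circle_point q \<xi>)) has_integral (N 0)\<^sup>2 * 0) {0..1}"
      by (rule circle_mean_cnj[of "\<lambda>z. (N z)\<^sup>2 * z"]) (intro holomorphic_intros hol)
    then show "((\<lambda>\<xi>. (w \<xi>)\<^sup>2 * cnj (circle_point q \<xi>)) has_integral 2 * N 0 * 0) {0..1}"
      by (rule has_integral_eq_rhs[OF has_integral_eq[rotated]]) (simp_all add: w)
  qed simp
qed

text \<open>After normalizing by D, compare the squared moduli of numerator and denominator on the
  circle. The first harmonic gives \<open>c = m * cnj a\<close>; the constant term gives
  \<open>|m| = 1\<close> or \<open>|a| = 1\<close>, and the nonzero determinant rules out the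
  latter. Finally \<open>m (1 - |a|^2) = p > 0\<close> forces \<open>m = 1\<close>: positivity of p
  is what removes the rotation.\<close>

lemma unimodular_moebius:
  fixes A B C D :: complex
  assumes CD: "norm C < norm D"
    and unimodular: "\<And>z. norm z = 1 \<Longrightarrow> norm (A * z + B) = norm (C * z + D)"
    and P: "(A * D - B * C) / D\<^sup>2 = of_real p" "0 < p"
  defines "a \<equiv> B / D"
  shows "norm a < 1" "\<And>z. (A * z + B) / (C * z + D) = (z + a) / (1 + cnj a * z)"
proof -
  define m c where "m = A / D" and "c = C / D"
  have D: "D \<noteq> 0" using CD by auto
  have ABC: "A = m * D" "B = a * D" "C = c * D"
    using D by (auto simp: m_def a_def c_def)
  have c: "norm c < 1" using CD D by (simp add: c_def norm_divide)
  have P': "m - a * c = of_real p"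
    using P(1) D by (simp add: ABC power2_eq_square diff_divide_distrib)
  have uni: "norm (m * z + a) = norm (c * z + 1)" if "norm z = 1" for z
  proof -
    have "norm D * norm (m * z + a) = norm D * norm (c * z + 1)"
      using unimodular[OF that] by (simp add: ABC algebra_simps flip: norm_mult)
    then show ?thesis using D by simp
  qed
  have sq: "m * cnj m + a * cnj a + (m * cnj a * z + cnj (m * cnj a * z)) =
      c * cnj c + 1 + (c * z + cnj (c * z))" if "norm z = 1" for z
  proof -
    have z: "z * cnj z = 1" using that by (simp flip: complex_norm_square)
    have "(m * z + a) * cnj (m * z + a) = (c * z + 1) * cnj (c * z + 1)"
      using uni[OF that] by (simp only: complex_norm_square[symmetric])
    moreover have "(m * z + a) * cnj (m * z + a) = m * cnj m * (z * cnj z) + a * cnj a + (m * cnj a * z + cnj (m * cnj a * z))"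
      by (simp add: algebra_simps)
    moreover have "(c * z + 1) * cnj (c * z + 1) = c * cnj c * (z * cnj z) + 1 + (c * z + cnj (c * z))"
      by (simp add: algebra_simps)
    ultimately show ?thesis by (simp only: z mult_1_right)
  qed
  \<comment> \<open>Replacing z by -z flips the first harmonic and keeps the constant term, which
    separates the two.\<close>
  have lin: "Re (m * cnj a * z) = Re (c * z)" if "norm z = 1" for z
  proof -
    define u w where "u = m * cnj a * z" and "w = c * z"
    have "m * cnj m + a * cnj a + (u + cnj u) = c * cnj c + 1 + (w + cnj w)"
        "m * cnj m + a * cnj a + (- u + cnj (- u)) = c * cnj c + 1 + (- w + cnj (- w))"
      using sq[OF that] sq[of "- z"] that by (simp_all add: u_def w_def)
    from this[THEN arg_cong[where f = Re]] show ?thesis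
      unfolding u_def[symmetric] w_def[symmetric] plus_complex.sel cnj.sel uminus_complex.sel by linarith
  qed
  have c_eq: "c = m * cnj a"
    using lin[of 1] lin[of \<i>] by (simp add: complex_eq_iff)
  have "m * cnj m + a * cnj a = c * cnj c + 1"
    using sq[of 1] by (simp add: c_eq)
  \<comment> \<open>With \<open>c = m * cnj a\<close> the constant term factors. The second factor
    cannot vanish, since its product with m is p.\<close>
  then have "(1 - m * cnj m) * (1 - a * cnj a) = 0"
    by (simp add: c_eq algebra_simps)
  moreover have "m * (1 - a * cnj a) = of_real p"
    using P' by (simp add: c_eq algebra_simps)
  moreover from this have "1 - a * cnj a \<noteq> 0"
    using P(2) by auto
  ultimately have "m * cnj m = 1" by simp
  then have "norm (m * cnj m) = 1" by simp
  then have norm_m: "norm m = 1"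
    by (simp add: norm_mult abs_square_eq_1 flip: power2_eq_square)
  have a: "norm a < 1"
    using c norm_m by (simp add: c_eq norm_mult)
  then show "norm a < 1" .
  have "0 < 1 - (norm a)\<^sup>2"
    using a by (simp add: power_less_one_iff abs_square_less_1)
  moreover have m_eq: "m * of_real (1 - (norm a)\<^sup>2) = of_real p"
    using \<open>m * (1 - a * cnj a) = of_real p\<close> by (simp add: complex_norm_square del: of_real_power)
  ultimately have "m = of_real (p / (1 - (norm a)\<^sup>2))"
    by (simp add: nonzero_eq_divide_eq del: of_real_diff of_real_power)
  moreover have "0 < p / (1 - (norm a)\<^sup>2)"
    using P(2) \<open>0 < 1 - (norm a)\<^sup>2\<close> by simp
  ultimately have "m = 1"
    using norm_m by (metis abs_of_pos norm_of_real of_real_1)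
  then show "(A * z + B) / (C * z + D) = (z + a) / (1 + cnj a * z)" for z
  proof -
    have "(A * z + B) / (C * z + D) = (D * (z + a)) / (D * (1 + cnj a * z))"
      by (simp add: ABC c_eq \<open>m = 1\<close> algebra_simps)
    then show ?thesis using D by simp
  qed
qed

lemma circle_point_inj:
  assumes "circle_point q \<xi> = circle_point q \<eta>" "\<bar>\<xi> - \<eta>\<bar> < 1"
  shows "\<xi> = \<eta>"
proof -
  have "cis_angle (to_angle (2 * pi * \<xi> + q)) = cis_angle (to_angle (2 * pi * \<eta> + q))"
    using assms(1) by (simp add: circle_point_def)
  then have "to_angle (2 * pi * \<xi> + q) = to_angle (2 * pi * \<eta> + q)"
    by (simp only: cis_angle_eq_iff)
  then obtain k :: int where "2 * pi * \<xi> + q - (2 * pi * \<eta> + q) = 2 * pi * of_int k"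
    by (auto simp: angle.abs_eq_iff cong_2pi_def)
  then have "2 * pi * (\<xi> - \<eta> - of_int k) = 0"
    by (simp add: algebra_simps)
  then have k: "\<xi> - \<eta> = of_int k" by simp
  then have "k = 0" using assms(2) by simp
  with k show ?thesis by simp
qed

section \<open>Orbits emanating from the twisted state\<close>

lemma kuramoto_complex_form:
  assumes "norm w = 1"
  shows "\<i> * of_real (Im (Z * cnj w)) * w = (Z - w\<^sup>2 * cnj Z) / 2"
proof -
  have w: "w * cnj w = 1" using assms by (simp flip: complex_norm_square)
  have "2 * (\<i> * of_real (Im (Z * cnj w)) * w) = (Z * cnj w - cnj (Z * cnj w)) * w"
    unfolding complex_diff_cnj by simp
  also have "\<dots> = Z * (w * cnj w) - w\<^sup>2 * cnj Z"
    by (simp add: power2_eq_square algebra_simps)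
  also have "\<dots> = Z - w\<^sup>2 * cnj Z"
    by (simp add: w)
  finally have eq: "2 * (\<i> * of_real (Im (Z * cnj w)) * w) = Z - w\<^sup>2 * cnj Z" .
  have "u = y / 2" if "2 * u = y" for u y :: complex
    using that by auto
  from this[OF eq] show ?thesis .
qed

lemma linear_ode_mult:
  fixes y z :: "real \<Rightarrow> complex"
  assumes "(y has_vector_derivative b * y t) (at t within T)" "(z has_vector_derivative c * z t) (at t within T)"
  shows "((\<lambda>t. y t * z t) has_vector_derivative (b + c) * (y t * z t)) (at t within T)"
  by (rule has_vector_derivative_eq_rhs[OF has_vector_derivative_mult[OF assms]])
    (simp add: algebra_simps)

locale unstable_orbit =
  fixes q :: real and x :: "real \<Rightarrow> real \<Rightarrow> angle"
  assumes solution: "kuramoto_solution {..0} x"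
    and limit: "limitin (mtopology_of state_space) x (twisted_state q) at_bot"
begin

definition w :: "real \<Rightarrow> real \<Rightarrow> complex" where "w t \<xi> = cis_angle (x t \<xi>)"

definition Z :: "real \<Rightarrow> complex" where "Z t = order_parameter (x t)"

definition P :: "real \<Rightarrow> complex" where
  "P t = integral {0..1} (\<lambda>\<xi>. w t \<xi> * cnj (circle_point q \<xi>))"

lemma state: "t \<le> 0 \<Longrightarrow> x t \<in> mspace state_space"
  using solution by (simp add: kuramoto_solution_def)

lemma norm_w [simp]: "norm (w t \<xi>) = 1"
  by (simp add: w_def)

lemma norm_Z: "norm (Z t) \<le> 1"
  by (simp add: Z_def norm_order_parameter_le)

lemma uniform_derivative:
  assumes "t \<le> 0"
  shows "uniform_limit {0..1} (\<lambda>s \<xi>. (w s \<xi> - w t \<xi>) / of_real (s - t))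
    (\<lambda>\<xi>. (Z t - (w t \<xi>)\<^sup>2 * cnj (Z t)) / 2) (at t within {..0})"
proof -
  have V: "kuramoto_rhs (x t) \<xi> = Im (Z t * cnj (w t \<xi>))" for \<xi>
    by (simp add: kuramoto_rhs_eq[OF state[OF assms]] Z_def w_def)
  have "\<bar>kuramoto_rhs (x t) \<xi>\<bar> \<le> 1" for \<xi>
    unfolding V using abs_Im_le_cmod[of "Z t * cnj (w t \<xi>)"] norm_Z[of t] by (simp add: norm_mult)
  moreover have "has_state_derivative x (kuramoto_rhs (x t)) (at t within {..0}) t"
    using solution assms by (simp add: kuramoto_solution_def)
  ultimately have "uniform_limit {0..1} (\<lambda>s \<xi>. (cis_angle (x s \<xi>) - cis_angle (x t \<xi>)) / of_real (s - t))
      (\<lambda>\<xi>. \<i> * of_real (kuramoto_rhs (x t) \<xi>) * cis_angle (x t \<xi>)) (at t within {..0})"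
    by (intro cis_state_derivative)
  then show ?thesis
    by (simp only: V w_def[symmetric] kuramoto_complex_form[OF norm_w])
qed

lemma pointwise_derivative:
  assumes "t \<le> 0" "\<xi> \<in> {0..1}"
  shows "((\<lambda>t. w t \<xi>) has_vector_derivative (Z t - (w t \<xi>)\<^sup>2 * cnj (Z t)) / 2) (at t within {..0})"
  unfolding has_vector_derivative_iff_quotient
  using tendsto_uniform_limitI[OF uniform_derivative[OF assms(1)] assms(2)] .

text \<open>The term \<open>Z\<close> is common to all \<xi> and cancels in the difference; the
  difference of squares then supplies the linear factor.\<close>

lemma difference_derivative:
  assumes "t \<le> 0" "\<xi> \<in> {0..1}" "\<eta> \<in> {0..1}"
  shows "((\<lambda>t. w t \<xi> - w t \<eta>) has_vector_derivative
    - (cnj (Z t) * (w t \<xi> + w t \<eta>) / 2) * (w t \<xi> - w t \<eta>)) (at t within {..0})"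
proof (rule has_vector_derivative_eq_rhs)
  show "((\<lambda>t. w t \<xi> - w t \<eta>) has_vector_derivative
      (Z t - (w t \<xi>)\<^sup>2 * cnj (Z t)) / 2 - (Z t - (w t \<eta>)\<^sup>2 * cnj (Z t)) / 2) (at t within {..0})"
    by (intro has_vector_derivative_diff pointwise_derivative assms)
  show "(Z t - (w t \<xi>)\<^sup>2 * cnj (Z t)) / 2 - (Z t - (w t \<eta>)\<^sup>2 * cnj (Z t)) / 2 =
      - (cnj (Z t) * (w t \<xi> + w t \<eta>) / 2) * (w t \<xi> - w t \<eta>)"
    by (simp add: power2_eq_square field_simps)
qed

lemma twisted_mem: "twisted_state q \<in> mspace state_space"
  using disc_state_mem[of 0 q] by (simp add: disc_state_0)

lemma mdist_lim: "((\<lambda>t. mdist state_space (x t) (twisted_state q)) \<longlongrightarrow> 0) at_bot"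
proof (rule tendstoI)
  fix e :: real assume "0 < e"
  then have "\<forall>\<^sub>F t in at_bot. x t \<in> mspace state_space \<and> mdist state_space (x t) (twisted_state q) < e"
    using limit limitin_state_space_iff[OF twisted_mem] by blast
  then show "\<forall>\<^sub>F t in at_bot. dist (mdist state_space (x t) (twisted_state q)) 0 < e"
    by eventually_elim simp
qed

lemma eventually_nonpos: "\<forall>\<^sub>F t in at_bot. t \<le> (0::real)"
  by (auto simp: eventually_at_bot_linorder)

lemma w_twisted_le:
  assumes "t \<le> 0" "\<xi> \<in> {0..1}"
  shows "norm (w t \<xi> - circle_point q \<xi>) \<le> mdist state_space (x t) (twisted_state q)"
proof -
  have "circle_point q \<xi> = cis_angle (twisted_state q \<xi>)"
    using assms(2) by (simp add: twisted_state_def circle_point_def)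
  then have "norm (w t \<xi> - circle_point q \<xi>) \<le> dist (x t \<xi>) (twisted_state q \<xi>)"
    by (simp add: w_def norm_cis_angle_diff_le)
  also have "\<dots> \<le> mdist state_space (x t) (twisted_state q)"
    by (rule dist_le_mdist_state_space[OF state[OF assms(1)] twisted_mem assms(2)])
  finally show ?thesis .
qed

lemma w_lim:
  assumes "\<xi> \<in> {0..1}"
  shows "((\<lambda>t. w t \<xi>) \<longlongrightarrow> circle_point q \<xi>) at_bot"
proof (rule LIM_zero_cancel, rule Lim_null_comparison[OF _ mdist_lim])
  show "\<forall>\<^sub>F t in at_bot. norm (w t \<xi> - circle_point q \<xi>) \<le> mdist state_space (x t) (twisted_state q)"
    using eventually_nonpos by eventually_elim (rule w_twisted_le[OF _ assms])
qed

text \<open>The difference solves a linear equation whose coefficient has norm at most 1, and its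
  limit in the past is nonzero. This keeps the denominators of the cross ratios from
  vanishing.\<close>

lemma w_distinct:
  assumes "t \<le> 0" "\<xi> \<in> {0..1}" "\<eta> \<in> {0..1}" "circle_point q \<xi> \<noteq> circle_point q \<eta>"
  shows "w t \<xi> \<noteq> w t \<eta>"
proof -
  have "norm (- (cnj (Z t) * (w t \<xi> + w t \<eta>) / 2)) \<le> 1" for t
  proof -
    have "norm (w t \<xi> + w t \<eta>) \<le> 2"
      using norm_triangle_ineq[of "w t \<xi>" "w t \<eta>"] by simp
    then have "norm (Z t) * norm (w t \<xi> + w t \<eta>) \<le> 1 * 2"
      using norm_Z[of t] by (intro mult_mono) auto
    then show ?thesis by (simp add: norm_mult norm_divide)
  qed
  then have "w t \<xi> - w t \<eta> \<noteq> 0"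
    by (intro linear_ode_nonzero[where y = "\<lambda>t. w t \<xi> - w t \<eta>" and L = "circle_point q \<xi> - circle_point q \<eta>",
          OF difference_derivative])
      (use assms in \<open>auto intro!: tendsto_diff w_lim\<close>)
  then show ?thesis by simp
qed

text \<open>The coefficient of a product of two differences involves only the sum of the four
  phases, so it is the same for both pairings of the points. For \<open>\<xi> = \<xi>3\<close> both
  sides are 0.\<close>

lemma cross_ratio:
  assumes t: "t \<le> 0" and \<xi>: "\<xi> \<in> {0..1}" "\<xi>1 \<in> {0..1}" "\<xi>2 \<in> {0..1}" "\<xi>3 \<in> {0..1}"
    and ne: "\<xi> \<noteq> \<xi>3 \<Longrightarrow> circle_point q \<xi> \<noteq> circle_point q \<xi>3" "circle_point q \<xi>2 \<noteq> circle_point q \<xi>1"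
  shows "(w t \<xi> - w t \<xi>1) * (w t \<xi>2 - w t \<xi>3) *
      ((circle_point q \<xi> - circle_point q \<xi>3) * (circle_point q \<xi>2 - circle_point q \<xi>1)) =
    (circle_point q \<xi> - circle_point q \<xi>1) * (circle_point q \<xi>2 - circle_point q \<xi>3) *
      ((w t \<xi> - w t \<xi>3) * (w t \<xi>2 - w t \<xi>1))"
proof (cases "\<xi> = \<xi>3")
  case False
  define c where "c t = - (cnj (Z t) * (w t \<xi> + w t \<xi>1 + w t \<xi>2 + w t \<xi>3) / 2)" for t
  have c: "- (cnj (Z t) * (w t \<xi> + w t \<xi>1) / 2) + - (cnj (Z t) * (w t \<xi>2 + w t \<xi>3) / 2) = c t"
      "- (cnj (Z t) * (w t \<xi> + w t \<xi>3) / 2) + - (cnj (Z t) * (w t \<xi>2 + w t \<xi>1) / 2) = c t" for t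
    by (simp_all add: c_def field_simps)
  show ?thesis
  proof (rule ratio_constant_limit[where c = c, OF _ _ _ _ _ _ t])
    fix s :: real assume s: "s \<le> 0"
    show "((\<lambda>t. (w t \<xi> - w t \<xi>1) * (w t \<xi>2 - w t \<xi>3)) has_vector_derivative
        c s * ((w s \<xi> - w s \<xi>1) * (w s \<xi>2 - w s \<xi>3))) (at s within {..0})"
      unfolding c(1)[symmetric] by (intro linear_ode_mult difference_derivative s \<xi>)
    show "((\<lambda>t. (w t \<xi> - w t \<xi>3) * (w t \<xi>2 - w t \<xi>1)) has_vector_derivative
        c s * ((w s \<xi> - w s \<xi>3) * (w s \<xi>2 - w s \<xi>1))) (at s within {..0})"
      unfolding c(2)[symmetric] by (intro linear_ode_mult difference_derivative s \<xi>)
    show "(w s \<xi> - w s \<xi>3) * (w s \<xi>2 - w s \<xi>1) \<noteq> 0"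
      using w_distinct[OF s \<xi>(1,4)] w_distinct[OF s \<xi>(3,2)] ne False by simp
  qed (use \<xi> ne False in \<open>auto intro!: tendsto_intros w_lim\<close>)
qed simp

lemma moebius:
  assumes t: "t \<le> 0"
  obtains A B C D where "A * D - B * C \<noteq> 0"
    "\<And>\<xi>. \<xi> \<in> {0..1} \<Longrightarrow> w t \<xi> * (C * circle_point q \<xi> + D) = A * circle_point q \<xi> + B"
proof -
  have ne: "circle_point q \<xi> \<noteq> circle_point q \<eta>" if "\<xi> \<noteq> \<eta>" "\<bar>\<xi> - \<eta>\<bar> < 1" for \<xi> \<eta>
    using circle_point_inj that by blast
  \<comment> \<open>Interior base points: every \<xi> in the interval has distance less than 1 from
    3/4, so \<open>circle_point_inj\<close> applies, while the ends 0 and 1 give the same point of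
    the circle.\<close>
  have v: "circle_point q (1/4) \<noteq> circle_point q (1/2)" "circle_point q (1/2) \<noteq> circle_point q (3/4)"
      "circle_point q (1/4) \<noteq> circle_point q (3/4)"
    by (rule ne; simp)+
  have w: "w t (1/4) \<noteq> w t (1/2)" "w t (1/2) \<noteq> w t (3/4)" "w t (1/4) \<noteq> w t (3/4)"
    by (rule w_distinct[OF t]; simp add: v)+
  obtain A B C D where ABCD: "A * D - B * C \<noteq> 0"
    "\<And>v' w'. (w' - w t (1/4)) * (w t (1/2) - w t (3/4)) * ((v' - circle_point q (3/4)) * (circle_point q (1/2) - circle_point q (1/4)))
      = (v' - circle_point q (1/4)) * (circle_point q (1/2) - circle_point q (3/4)) * ((w' - w t (3/4)) * (w t (1/2) - w t (1/4))) \<Longrightarrow>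
      w' * (C * v' + D) = A * v' + B"
    by (rule moebius_of_cross_ratio[OF v w]) (rule that)
  show ?thesis
  proof (rule that[OF ABCD(1)])
    show "w t \<xi> * (C * circle_point q \<xi> + D) = A * circle_point q \<xi> + B" if "\<xi> \<in> {0..1}" for \<xi>
    proof (rule ABCD(2), rule cross_ratio)
      show "circle_point q \<xi> \<noteq> circle_point q (3/4)" if "\<xi> \<noteq> 3/4"
        using \<open>\<xi> \<in> {0..1}\<close> by (intro ne that) (simp add: abs_less_iff)
    qed (use t that v(1) in auto)
  qed
qed

text \<open>The transformation is chosen anew for each t, but its coefficients are eliminated here:
  the second moment is expressed through \<open>Z\<close> and \<open>P\<close>, which closes the
  evolution equation of \<open>P\<close>.\<close>

lemma moments:
  assumes t: "t \<le> 0"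
  shows "((\<lambda>\<xi>. w t \<xi> * cnj (circle_point q \<xi>)) has_integral P t) {0..1}"
    "((\<lambda>\<xi>. (w t \<xi>)\<^sup>2 * cnj (circle_point q \<xi>)) has_integral 2 * Z t * P t) {0..1}"
proof -
  obtain A B C D where det: "A * D - B * C \<noteq> 0"
    and eq: "\<And>\<xi>. \<xi> \<in> {0..1} \<Longrightarrow> w t \<xi> * (C * circle_point q \<xi> + D) = A * circle_point q \<xi> + B"
    by (rule moebius[OF t]) (rule that)
  obtain Z' P' where Z': "(w t has_integral Z') {0..1}"
    and P': "((\<lambda>\<xi>. w t \<xi> * cnj (circle_point q \<xi>)) has_integral P') {0..1}"
    and R: "((\<lambda>\<xi>. (w t \<xi>)\<^sup>2 * cnj (circle_point q \<xi>)) has_integral 2 * Z' * P') {0..1}"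
    by (rule moebius_moments[OF det eq], assumption, rule that)
  have "Z t = integral {0..1} (w t)"
    by (simp add: Z_def order_parameter_def w_def[abs_def])
  then have "Z t = Z'" "P t = P'"
    using Z' P' by (simp_all add: P_def integral_unique)
  with P' R show "((\<lambda>\<xi>. w t \<xi> * cnj (circle_point q \<xi>)) has_integral P t) {0..1}"
    "((\<lambda>\<xi>. (w t \<xi>)\<^sup>2 * cnj (circle_point q \<xi>)) has_integral 2 * Z t * P t) {0..1}"
    by simp_all
qed

text \<open>Integrate the Riccati equation against \<open>cnj v\<close>: the term with
  \<open>Z\<close> drops out since \<open>cnj v\<close> has mean 0, and the quadratic term gives
  \<open>- cnj Z * (2 * Z * P) / 2\<close>.\<close>

lemma P_derivative:
  assumes t: "t \<le> 0"
  shows "(P has_vector_derivative - of_real ((norm (Z t))\<^sup>2) * P t) (at t within {..0})"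
proof (rule has_vector_derivative_integral_uniform[OF uniform_derivative[OF t]])
  have "((\<lambda>\<xi>. Z t * cnj (circle_point q \<xi>) / 2 - cnj (Z t) * ((w t \<xi>)\<^sup>2 * cnj (circle_point q \<xi>)) / 2)
      has_integral Z t * 0 / 2 - cnj (Z t) * (2 * Z t * P t) / 2) {0..1}"
    by (intro has_integral_diff has_integral_divide has_integral_mult_right moments t
        circle_mean_cnj[of "\<lambda>z. z"]) (auto intro: holomorphic_intros)
  then show "((\<lambda>\<xi>. (Z t - (w t \<xi>)\<^sup>2 * cnj (Z t)) / 2 * cnj (circle_point q \<xi>)) has_integral
      - of_real ((norm (Z t))\<^sup>2) * P t) {0..1}"
    by (rule has_integral_eq_rhs[OF has_integral_eq[rotated]])
      (simp_all add: complex_norm_square field_simps del: of_real_power)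
qed (use t moments in auto)

lemma P_lim: "(P \<longlongrightarrow> 1) at_bot"
proof (rule LIM_zero_cancel, rule Lim_null_comparison[OF _ mdist_lim])
  show "\<forall>\<^sub>F t in at_bot. norm (P t - 1) \<le> mdist state_space (x t) (twisted_state q)"
    using eventually_nonpos
  proof eventually_elim
    case (elim t)
    have "((\<lambda>\<xi>. w t \<xi> * cnj (circle_point q \<xi>) - 1) has_integral P t - 1) (cbox 0 1)"
      using has_integral_diff[OF moments(1)[OF elim] has_integral_const_real[of 1 0 1]] by simp
    moreover have "norm (w t \<xi> * cnj (circle_point q \<xi>) - 1) \<le> mdist state_space (x t) (twisted_state q)"
      if "\<xi> \<in> cbox 0 1" for \<xi>
    proof -
      have "w t \<xi> * cnj (circle_point q \<xi>) - 1 = (w t \<xi> - circle_point q \<xi>) * cnj (circle_point q \<xi>)"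
        by (simp add: algebra_simps)
      then show ?thesis
        using w_twisted_le[OF elim, of \<xi>] that by (simp add: norm_mult)
    qed
    ultimately have "norm (P t - 1) \<le> mdist state_space (x t) (twisted_state q) * measure lborel (cbox 0 (1::real))"
      by (intro has_integral_bound) auto
    then show ?case by simp
  qed
qed

text \<open>Because \<open>- |Z|^2\<close> is real, \<open>P\<close> and \<open>cnj P\<close> solve
  the same equation with the same limit 1, hence agree. \<open>P\<close> has no zero, so by
  continuity the positive sign near minus infinity persists up to time 0.\<close>

lemma P_positive: obtains p where "P 0 = of_real p" "0 < p"
proof -
  have nz: "P t \<noteq> 0" if "t \<le> 0" for t
    by (rule linear_ode_nonzero[OF P_derivative _ P_lim _ that])
      (use norm_Z in \<open>auto simp: norm_power power_le_one\<close>)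
  have "P t * 1 = 1 * cnj (P t)" if "t \<le> 0" for t
  proof (rule ratio_constant_limit[OF P_derivative _ _ P_lim _ _ that])
    show "((\<lambda>t. cnj (P t)) has_vector_derivative - of_real ((norm (Z t))\<^sup>2) * cnj (P t)) (at t within {..0})"
      if "t \<le> 0" for t
      using has_vector_derivative_cnj[OF P_derivative[OF that]] by simp
    show "((\<lambda>t. cnj (P t)) \<longlongrightarrow> 1) at_bot"
      using tendsto_cnj[OF P_lim] by simp
  qed (use nz in auto)
  then have real: "P t = of_real (Re (P t))" if "t \<le> 0" for t
    using that by (simp add: complex_eq_iff)
  then have Re_nz: "Re (P t) \<noteq> 0" if "t \<le> 0" for t
    using nz[OF that] that by (metis of_real_0)
  have "((\<lambda>t. Re (P t)) \<longlongrightarrow> 1) at_bot"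
    using tendsto_Re[OF P_lim] by simp
  then have "\<forall>\<^sub>F t in at_bot. 0 < Re (P t) \<and> t \<le> 0"
    by (intro eventually_conj eventually_nonpos order_tendstoD(1)) auto
  then obtain s where s: "0 < Re (P s)" "s \<le> 0"
    using eventually_happens[of _ "at_bot :: real filter"] by auto
  have "0 < Re (P 0)"
  proof (rule ccontr)
    assume "\<not> 0 < Re (P 0)"
    moreover have "continuous_on {..0} P"
      unfolding continuous_on_eq_continuous_within
      using P_derivative has_vector_derivative_continuous by blast
    then have "continuous_on {s..0} (\<lambda>t. Re (P t))"
      by (intro continuous_on_Re) (rule continuous_on_subset, auto)
    ultimately obtain t where "s \<le> t" "t \<le> 0" "Re (P t) = 0"
      using IVT2'[of "\<lambda>t. Re (P t)" 0 0 s] s by auto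
    then show False using Re_nz by simp
  qed
  then show ?thesis using that real[of 0] by simp
qed

lemma endpoint: "x 0 \<in> disc_states q"
proof -
  obtain p where p: "P 0 = of_real p" "0 < p"
    using P_positive .
  obtain A B C D where det: "A * D - B * C \<noteq> 0"
    and eq: "\<And>\<xi>. \<xi> \<in> {0..1} \<Longrightarrow> w 0 \<xi> * (C * circle_point q \<xi> + D) = A * circle_point q \<xi> + B"
    by (rule moebius[OF order_refl]) (rule that)
  obtain P' where P': "((\<lambda>\<xi>. w 0 \<xi> * cnj (circle_point q \<xi>)) has_integral P') {0..1}"
    "P' \<noteq> 0 \<Longrightarrow> norm C < norm D \<and> P' = (A * D - B * C) / D\<^sup>2"
    by (rule moebius_moments[OF det eq], assumption, rule that)
  have "P' = P 0"
    using P'(1) by (simp add: P_def integral_unique)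
  \<comment> \<open>A pole inside the disc would make \<open>P 0\<close> vanish.\<close>
  with P'(2) p have CD: "norm C < norm D" and "(A * D - B * C) / D\<^sup>2 = of_real p"
    by auto
  moreover have "norm (A * z + B) = norm (C * z + D)" if z: "norm z = 1" for z
  proof -
    obtain \<xi> where "\<xi> \<in> {0..1}" "circle_point q \<xi> = z"
      using circle_point_surj[OF z] by blast
    then have "A * z + B = w 0 \<xi> * (C * z + D)"
      using eq by metis
    then show ?thesis by (simp add: norm_mult)
  qed
  ultimately have a: "norm (B / D) < 1"
    and form: "\<And>z. (A * z + B) / (C * z + D) = (z + B / D) / (1 + cnj (B / D) * z)"
    using unimodular_moebius[OF CD] p(2) by blast+
  have "x 0 = disc_state q (B / D)"
  proof (rule extensionalityI[of _ "{0..1}"])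
    show "x 0 \<in> extensional {0..1}"
      using state[of 0] by (simp add: mem_state_space_iff)
    show "disc_state q (B / D) \<in> extensional {0..1}"
      by (simp add: disc_state_def)
    fix \<xi> :: real assume \<xi>: "\<xi> \<in> {0..1}"
    have "C * circle_point q \<xi> + D \<noteq> 0"
      using linear_nonzero_cball[OF CD] by simp
    then have "w 0 \<xi> = (A * circle_point q \<xi> + B) / (C * circle_point q \<xi> + D)"
      using eq[OF \<xi>] by (simp add: eq_divide_eq)
    then have "cis_angle (x 0 \<xi>) = cis_angle (disc_state q (B / D) \<xi>)"
      using form cis_disc_state[OF a \<xi>, of q] by (simp add: w_def)
    then show "x 0 \<xi> = disc_state q (B / D) \<xi>" by simp
  qed
  then show ?thesis using a by (auto simp: disc_states_def)
qed

end

section \<open>Identification of the unstable manifold\<close>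

lemma unstable_manifold_twisted_state: "unstable_manifold (twisted_state q) = disc_states q"
proof (intro equalityI subsetI)
  fix y assume "y \<in> unstable_manifold (twisted_state q)"
  then obtain x where "unstable_orbit q x" "x 0 = y"
    by (auto simp: unstable_manifold_def unstable_orbit_def)
  then show "y \<in> disc_states q"
    using unstable_orbit.endpoint by blast
next
  fix y assume "y \<in> disc_states q"
  then show "y \<in> unstable_manifold (twisted_state q)"
    by (auto simp: disc_states_def disc_state_in_unstable_manifold)
qed

theorem theorem2p6:
  fixes q :: real
  shows "kuramoto_solution UNIV (\<lambda>_. twisted_state q) \<and>
    embedded_smooth_surface (unstable_manifold (twisted_state q)) \<and>
    unstable_manifold (twisted_state q) =
      {oa_state q \<alpha> \<beta> | \<alpha> \<beta>. \<beta> \<in> {0..<1} \<and> \<alpha> \<in> {-pi..pi}} \<and>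
    (\<forall>T \<alpha> \<beta>. is_interval T \<and> oa_parameter_solution T \<alpha> \<beta> \<longrightarrow>
      kuramoto_solution T (\<lambda>t. oa_state q (\<alpha> t) (\<beta> t)) \<and>
      mean_field_solution T (\<lambda>t. oa_density (\<alpha> t) (\<beta> t)) \<and>
      (\<forall>t\<in>T. oa_state q (\<alpha> t) (\<beta> t) \<in> unstable_manifold (twisted_state q) \<and>
             oa_density (\<alpha> t) (\<beta> t) \<in> oa_manifold))"
proof (intro conjI allI impI ballI)
  \<comment> \<open>The twisted state is the Moebius state with \<open>a = 0\<close>, a rest point
    of the reduced equation.\<close>
  have "kuramoto_solution UNIV (\<lambda>_. disc_state q 0)"
    by (rule kuramoto_solution_disc_state) auto
  then show "kuramoto_solution UNIV (\<lambda>_. twisted_state q)"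
    by (simp add: disc_state_0)
  show "embedded_smooth_surface (unstable_manifold (twisted_state q))"
    by (simp add: unstable_manifold_twisted_state embedded_smooth_surface_disc_states)
  show unstable: "unstable_manifold (twisted_state q) =
      {oa_state q \<alpha> \<beta> | \<alpha> \<beta>. \<beta> \<in> {0..<1} \<and> \<alpha> \<in> {-pi..pi}}"
    by (simp only: unstable_manifold_twisted_state oa_states_eq_disc_states)
  fix T \<alpha> \<beta> assume "is_interval T \<and> oa_parameter_solution T \<alpha> \<beta>"
  then have sol: "oa_parameter_solution T \<alpha> \<beta>" ..
  show "kuramoto_solution T (\<lambda>t. oa_state q (\<alpha> t) (\<beta> t))"
    by (rule kuramoto_solution_oa_state[OF sol])
  show "mean_field_solution T (\<lambda>t. oa_density (\<alpha> t) (\<beta> t))"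
    by (rule mean_field_solution_oa_density[OF sol])
  fix t assume "t \<in> T"
  then have "\<beta> t \<in> {0..<1} \<and> \<alpha> t \<in> {-pi..pi}"
    using sol by (auto simp: oa_parameter_solution_def)
  then show "oa_state q (\<alpha> t) (\<beta> t) \<in> unstable_manifold (twisted_state q)"
      "oa_density (\<alpha> t) (\<beta> t) \<in> oa_manifold"
    unfolding unstable oa_manifold_def by blast+
qed

end
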